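(* Let $n\ge1$, $c>0$, $T>0$. For any (sufficiently regular and decaying, real-valued) $f$, $g$ and $F$, the solution $u$ of the Cauchy problem $$ \begin{cases} (\partial_t^2-c^2\Delta)u(t,x)=F(t,x) & \text{for }(t,x)\in[0,T]\times\mathbb{R}^n,\\ u(0,\cdot)=f(\cdot),\quad\partial_tu(0,\cdot)=g(\cdot) \end{cases} $$ satisfies $$ \begin{aligned} \max\Big[&\sup_{0\le t\le T}\int_{\mathbb{R}^n}(\partial_tu(t,x))^2+c^2|\nabla u(t,x)|^2\,dx,\\ &\sup_{0<\kappa<\infty}\frac{c\kappa}{4}\int_0^T\!\!\int_{\mathbb{R}^n}\frac{1}{(1+|ct-|x||)^{1+\kappa}}\Big\{(\overline\partial_{c0}u)^2+c^2\sum_{j=1}^n(\overline\partial_{cj}u)^2\Big\}dx\,dt,\\ &\frac{c}{6\log(e+cT)}\int_0^T\!\!\int_{\mathbb{R}^n}\frac{1}{1+|ct-|x||}\Big\{(\overline\partial_{c0}u)^2+c^2\sum_{j=1}^n(\overline\partial_{cj}u)^2\Big\}dx\,dt\Big]\\ &\le\int_{\mathbb{R}^n}g^2+c^2|\nabla f|^2\,dx+2\int_0^T\!\!\int_{\mathbb{R}^n}|(\partial_tu)F|\,dx\,dt . \end{aligned} $$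
   Context: $\Delta=\sum_{j=1}^n\partial_j^2$, $\nabla=(\partial_1,\dots,\partial_n)$, $r=|x|$, $\partial_r=r^{-1}\sum_{j=1}^nx_j\partial_j$. The tangential derivatives along the speed-$c$ light cone are $\overline\partial_c=(\overline\partial_{c0},\overline\partial_{c1},\dots,\overline\partial_{cn})$, defined by $\overline\partial_{c}=(\partial_t+c\partial_r,\ \nabla-\frac{x}{r}\partial_r)$ for $n\ge2$ and $\overline\partial_c=(\partial_t+c\partial_r,0)$ for $n=1$. *)

theory Defs
  imports "HOL-Analysis.Analysis"
begin

text \<open>
  A space-time function is a map \<open>u :: real \<Rightarrow> real ^ 'n \<Rightarrow> real\<close>, with time first. It is only
  ever looked at on the closed slab \<open>{0..T} \<times> UNIV\<close>; time derivatives are therefore taken within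
  \<open>{0..T}\<close>, i.e. they are one-sided at \<open>t = 0\<close> and \<open>t = T\<close>.
\<close>

definition dt :: "real \<Rightarrow> (real \<Rightarrow> real ^ 'n \<Rightarrow> real) \<Rightarrow> real \<Rightarrow> real ^ 'n \<Rightarrow> real"
  where "dt T u t x = vector_derivative (\<lambda>s. u s x) (at t within {0..T})"

definition dx :: "'n \<Rightarrow> (real ^ 'n \<Rightarrow> real) \<Rightarrow> real ^ 'n \<Rightarrow> real"
  where "dx j v x = deriv (\<lambda>s. v (x + s *\<^sub>R axis j 1)) 0"

definition grad :: "(real ^ 'n \<Rightarrow> real) \<Rightarrow> real ^ 'n \<Rightarrow> real ^ 'n"
  where "grad v x = (\<chi> j. dx j v x)"

definition laplacian :: "(real ^ 'n \<Rightarrow> real) \<Rightarrow> real ^ 'n \<Rightarrow> real"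
  where "laplacian v x = (\<Sum>j\<in>UNIV. dx j (dx j v) x)"

text \<open>
  At \<open>x = 0\<close> the next three operators take junk values (division by zero); they are only used under
  integrals over \<open>real ^ 'n\<close>, for which the origin is a null set.
\<close>

definition dr :: "(real ^ 'n \<Rightarrow> real) \<Rightarrow> real ^ 'n \<Rightarrow> real"
  where "dr v x = (1 / norm x) * (\<Sum>j\<in>UNIV. x $ j * dx j v x)"

definition tang0 :: "real \<Rightarrow> real \<Rightarrow> (real \<Rightarrow> real ^ 'n \<Rightarrow> real) \<Rightarrow> real \<Rightarrow> real ^ 'n \<Rightarrow> real"
  where "tang0 T c u t x = dt T u t x + c * dr (u t) x"

definition tang :: "'n \<Rightarrow> (real \<Rightarrow> real ^ 'n \<Rightarrow> real) \<Rightarrow> real \<Rightarrow> real ^ 'n \<Rightarrow> real"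
  where "tang j u t x =
    (if CARD('n) = 1 then 0 else dx j (u t) x - x $ j / norm x * dr (u t) x)"

definition tang_energy :: "real \<Rightarrow> real \<Rightarrow> (real \<Rightarrow> real ^ 'n \<Rightarrow> real) \<Rightarrow> real \<Rightarrow> real ^ 'n \<Rightarrow> real"
  where "tang_energy T c u t x =
    (tang0 T c u t x)\<^sup>2 + c\<^sup>2 * (\<Sum>j\<in>UNIV. (tang j u t x)\<^sup>2)"

text \<open>
  \<open>C_slab T k u\<close>: \<open>u\<close> is of class \<open>C\<^sup>k\<close> on \<open>[0,T] \<times> \<real>\<^sup>n\<close>, i.e. all iterated space-time partial
  derivatives up to order \<open>k\<close> exist there and are jointly continuous up to the boundary.
\<close>

primrec C_slab :: "real \<Rightarrow> nat \<Rightarrow> (real \<Rightarrow> real ^ 'n \<Rightarrow> real) \<Rightarrow> bool"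
  where
    "C_slab T 0 u \<longleftrightarrow> continuous_on ({0..T} \<times> UNIV) (\<lambda>(t, x). u t x)"
  | "C_slab T (Suc k) u \<longleftrightarrow>
      continuous_on ({0..T} \<times> UNIV) (\<lambda>(t, x). u t x) \<and>
      (\<forall>t\<in>{0..T}. \<forall>x.
        (\<lambda>s. u s x) differentiable (at t within {0..T}) \<and>
        (\<forall>j. (\<lambda>s. u t (x + s *\<^sub>R axis j 1)) differentiable (at 0))) \<and>
      C_slab T k (dt T u) \<and>
      (\<forall>j. C_slab T k (\<lambda>t. dx j (u t)))"

text \<open>
  Classical solutions of the Cauchy problem. The data are as regular as a \<open>C\<^sup>2\<close> solution
  forces them to be (\<open>f\<close> is \<open>C\<^sup>2\<close>, \<open>g\<close> is \<open>C\<^sup>1\<close>, \<open>F\<close> is continuous on the slab).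
  No decay is required: the estimate is stated in \<open>ennreal\<close>, so it is void unless the data decay enough
  for its right-hand side to be finite, and in that case it includes finiteness of the left-hand side.
\<close>

definition wave_solution ::
  "real \<Rightarrow> real \<Rightarrow> (real ^ 'n \<Rightarrow> real) \<Rightarrow> (real ^ 'n \<Rightarrow> real) \<Rightarrow> (real \<Rightarrow> real ^ 'n \<Rightarrow> real)
    \<Rightarrow> (real \<Rightarrow> real ^ 'n \<Rightarrow> real) \<Rightarrow> bool"
  where "wave_solution T c f g F u \<longleftrightarrow>
    C_slab T 2 u \<and>
    (\<forall>t\<in>{0..T}. \<forall>x. dt T (dt T u) t x - c\<^sup>2 * laplacian (u t) x = F t x) \<and>
    (\<forall>x. u 0 x = f x) \<and>
    (\<forall>x. dt T u 0 x = g x)"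

end

theory Submission
  imports Defs
begin

text \<open>
  Multiply the equation by \<open>2 \<Phi> \<partial>\<^sub>tu\<close> with the weight \<open>\<Phi> = \<phi>(ct - r) \<chi>(ct + r)\<close>, where \<open>\<phi>\<close> and \<open>\<chi>\<close> are
  nonnegative and decreasing and \<open>\<chi>\<close> vanishes beyond \<open>R\<close>. With \<open>e = (\<partial>\<^sub>tu)\<^sup>2 + c\<^sup>2|\<nabla>u|\<^sup>2\<close>, the derivative
  of \<open>\<phi>\<close> produces \<open>c \<phi>' (e + 2c \<partial>\<^sub>tu \<partial>\<^sub>ru)\<close>, which is exactly \<open>c \<phi>'\<close> times the tangential energy, and that
  of \<open>\<chi>\<close> produces \<open>c \<chi>' (e - 2c \<partial>\<^sub>tu \<partial>\<^sub>ru)\<close>; both have a good sign. Hence \<open>c \<integral>\<integral> |\<phi>'|\<close> times the tangential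
  energy is at most \<open>sup \<phi>\<close> times the right-hand side. Finite speed of propagation is built into \<open>\<chi>\<close>, so no
  decay of \<open>u\<close> is needed: let \<open>R \<rightarrow> \<infinity>\<close> and apply Fatou's lemma.

  For the logarithmic bound take \<open>|\<phi>'(s)| = Y / ((1 + |s|)(Y + |s|))\<close> with \<open>Y = 1 + cT\<close>, of total mass at most
  \<open>2 (log Y + 1)\<close>; it differs from \<open>1 / (1 + |s|)\<close> by at most \<open>1 / Y\<close>, and this error is absorbed by
  integrating the energy estimate over \<open>[0,T]\<close>.
\<close>

section \<open>Integrals of compactly supported directional derivatives\<close>

text \<open>Moving the base point turns differentiability at parameter 0, the only kind that
  \<open>dx\<close> provides, into differentiability along the whole line, as the mean value theorem
  and the Leibniz rule require.\<close>

lemma has_real_derivative_along_line: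
  fixes v :: "'a::real_vector \<Rightarrow> real"
  assumes "\<And>x. ((\<lambda>s. v (x + s *\<^sub>R a)) has_real_derivative v' x) (at 0)"
  shows "((\<lambda>s. v (x + s *\<^sub>R a)) has_real_derivative v' (x + s *\<^sub>R a)) (at s)"
  using assms[of "x + s *\<^sub>R a"] DERIV_shift[of "\<lambda>s. v (x + s *\<^sub>R a)" "v' (x + s *\<^sub>R a)" 0 s]
  by (simp add: algebra_simps)

lemma integrable_compact_support:
  fixes h :: "'a::euclidean_space \<Rightarrow> real"
  assumes "continuous_on UNIV h" "\<And>x. norm x > K \<Longrightarrow> h x = 0"
  shows "integrable lborel h"
proof -
  have "integrable lborel (\<lambda>x. indicator (cball 0 K) x *\<^sub>R h x)"
    using assms by (intro borel_integrable_compact) (auto intro: continuous_on_subset)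
  also have "(\<lambda>x. indicator (cball 0 K) x *\<^sub>R h x) = h"
    using assms(2) by (auto simp: indicator_def fun_eq_iff not_le)
  finally show ?thesis .
qed

text \<open>Translation invariance of Lebesgue measure makes every difference quotient of
  \<open>h\<close> integrate to 0, and dominated convergence carries this over to the derivative. It
  acts as a divergence theorem with no boundary term.\<close>

lemma integral_directional_derivative_eq_0:
  fixes h h' :: "'a::euclidean_space \<Rightarrow> real"
  assumes cont: "continuous_on UNIV h" "continuous_on UNIV h'"
    and deriv: "\<And>x. ((\<lambda>s. h (x + s *\<^sub>R a)) has_real_derivative h' x) (at 0)"
    and supp: "\<And>x. norm x > K \<Longrightarrow> h x = 0" "\<And>x. norm x > K \<Longrightarrow> h' x = 0"
  shows "(\<integral>x. h' x \<partial>lborel) = 0"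
proof -
  have "bounded (h' ` cball 0 K)"
    by (intro compact_imp_bounded compact_continuous_image continuous_on_subset[OF cont(2)]) auto
  then obtain B0 where B0: "\<And>x. x \<in> cball 0 K \<Longrightarrow> \<bar>h' x\<bar> \<le> B0"
    unfolding bounded_iff by fastforce
  define B where "B = max B0 0"
  have B: "\<bar>h' x\<bar> \<le> B" for x
    using B0[of x] supp(2)[of x] by (cases "norm x \<le> K") (auto simp: B_def)
  have "B \<ge> 0" by (simp add: B_def)
  \<comment> \<open>The mean value theorem bounds the difference quotients uniformly, which gives
    the domination below.\<close>
  have lip: "\<bar>h (x + d *\<^sub>R a) - h x\<bar> \<le> B * d" if "d > 0" for x d
  proof -
    have "\<exists>z. 0 < z \<and> z < d \<and> h (x + d *\<^sub>R a) - h (x + 0 *\<^sub>R a) = (d - 0) * h' (x + z *\<^sub>R a)"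
      using that by (intro MVT2 has_real_derivative_along_line[OF deriv])
    then obtain z where "h (x + d *\<^sub>R a) - h x = d * h' (x + z *\<^sub>R a)" by auto
    then show ?thesis
      using B[of "x + z *\<^sub>R a"] that by (simp add: abs_mult mult.commute)
  qed
  define d where "d n = 1 / real (Suc n)" for n
  have d: "0 < d n" "d n \<le> 1" for n by (auto simp: d_def)
  define q where "q n x = (h (x + d n *\<^sub>R a) - h x) / d n" for n x
  have int_h: "integrable lborel h"
    by (rule integrable_compact_support[OF cont(1) supp(1)])
  have int_shift: "integrable lborel (\<lambda>x. h (x + b))" "(\<integral>x. h (x + b) \<partial>lborel) = (\<integral>x. h x \<partial>lborel)" for b
  proof -
    have [measurable]: "h \<in> borel_measurable borel"
      using cont(1) by (rule borel_measurable_continuous_onI)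
    have "integrable (distr lborel borel ((+) b)) h"
      using int_h by (simp add: lborel_distr_plus)
    then show "integrable lborel (\<lambda>x. h (x + b))"
      by (subst (asm) integrable_distr_eq) (auto simp: add.commute)
    have "(\<integral>x. h x \<partial>distr lborel borel ((+) b)) = (\<integral>x. h (b + x) \<partial>lborel)"
      by (rule integral_distr) auto
    then show "(\<integral>x. h (x + b) \<partial>lborel) = (\<integral>x. h x \<partial>lborel)"
      by (simp add: lborel_distr_plus add.commute)
  qed
  have int_q: "(\<integral>x. q n x \<partial>lborel) = 0" for n
    unfolding q_def using int_shift[of "d n *\<^sub>R a"] int_h by simp
  have "(\<lambda>n. \<integral>x. q n x \<partial>lborel) \<longlonglongrightarrow> (\<integral>x. h' x \<partial>lborel)"
  proof (rule integral_dominated_convergence)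
    show "h' \<in> borel_measurable lborel"
      using cont(2) by (simp add: borel_measurable_continuous_onI)
    show "q n \<in> borel_measurable lborel" for n
      unfolding q_def using cont(1)
      by (intro borel_measurable_integrable integrable_divide Bochner_Integration.integrable_diff
          int_shift int_h) 
    \<comment> \<open>Since \<open>d n \<le> 1\<close>, a shift moves the support by at most
      \<open>norm a\<close>, hence the enlarged ball.\<close>
    show "integrable lborel (\<lambda>x. indicator (cball 0 (K + norm a)) x *\<^sub>R B)"
      by (intro borel_integrable_compact) auto
    show "AE x in lborel. (\<lambda>n. q n x) \<longlonglongrightarrow> h' x"
    proof (rule AE_I2)
      fix x
      have "(\<lambda>r. (h (x + r *\<^sub>R a) - h x) / r) \<midarrow>0\<rightarrow> h' x"
        using deriv[of x] by (simp add: DERIV_def)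
      moreover have "filterlim d (at 0) sequentially"
      proof (subst filterlim_at, intro conjI)
        show "\<forall>\<^sub>F n in sequentially. d n \<in> UNIV \<and> d n \<noteq> 0"
          using d(1) by (intro always_eventually) (metis UNIV_I less_irrefl)
        show "d \<longlonglongrightarrow> 0" unfolding d_def by (rule LIMSEQ_Suc[OF lim_1_over_n])
      qed
      ultimately show "(\<lambda>n. q n x) \<longlonglongrightarrow> h' x"
        unfolding q_def by (rule filterlim_compose)
    qed
    show "AE x in lborel. norm (q n x) \<le> indicator (cball 0 (K + norm a)) x *\<^sub>R B" for n
    proof (rule AE_I2)
      fix x
      show "norm (q n x) \<le> indicator (cball 0 (K + norm a)) x *\<^sub>R B"
      proof (cases "norm x \<le> K + norm a")
        case True
        then show ?thesis
          using lip[OF d(1), of x n] d[of n] by (simp add: q_def field_simps)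
      next
        case False
        have "norm x - d n * norm a \<le> norm (x + d n *\<^sub>R a)"
          using norm_triangle_ineq4[of "x + d n *\<^sub>R a" "d n *\<^sub>R a"] d(1)[of n] by simp
        moreover have "d n * norm a \<le> norm a"
          using d[of n] by (simp add: mult_left_le_one_le)
        ultimately have "norm (x + d n *\<^sub>R a) > K" "norm x > K"
          using False norm_ge_zero[of a] by linarith+
        then show ?thesis using supp(1) \<open>B \<ge> 0\<close> by (simp add: q_def)
      qed
    qed
  qed
  then show ?thesis by (simp add: int_q LIMSEQ_const_iff)
qed

section \<open>Regularity on the slab and symmetry of mixed derivatives\<close>

lemma C_slab_continuous:
  "C_slab T k u \<Longrightarrow> continuous_on ({0..T} \<times> UNIV) (\<lambda>p. u (fst p) (snd p))"
  by (cases k) (auto simp: case_prod_unfold)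

lemma continuous_on_slab_compose:
  assumes "continuous_on (I \<times> UNIV) (\<lambda>p. A (fst p) (snd p))"
    and "continuous_on S a" "continuous_on S b" "\<And>p. p \<in> S \<Longrightarrow> a p \<in> I"
  shows "continuous_on S (\<lambda>p. A (a p) (b p))"
  using continuous_on_compose2[OF assms(1) continuous_on_Pair[OF assms(2,3)]] assms(4) by auto

lemma C_slab_Suc_has_dt:
  assumes "C_slab T (Suc k) u" "t \<in> {0..T}"
  shows "((\<lambda>s. u s x) has_vector_derivative dt T u t x) (at t within {0..T})"
  using assms unfolding dt_def by (simp add: vector_derivative_works)

lemma C_slab_Suc_has_dx:
  assumes "C_slab T (Suc k) u" "t \<in> {0..T}"
  shows "((\<lambda>s. u t (x + s *\<^sub>R axis j 1)) has_real_derivative dx j (u t) x) (at 0)"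
  using assms unfolding dx_def by (simp add: DERIV_deriv_iff_real_differentiable)

text \<open>\<open>C_slab\<close> grants both mixed derivatives but does not state that they agree.
  The time integral of \<open>dt T u\<close> recovers \<open>u\<close> from \<open>u 0\<close>; the
  Leibniz rule moves \<open>dx j\<close> under that integral, and differentiating in the upper limit
  gives \<open>dx j (dt T u)\<close>.\<close>

lemma C_slab_has_dt_dx:
  fixes u :: "real \<Rightarrow> real ^ 'n \<Rightarrow> real"
  assumes C2: "C_slab T (Suc (Suc k)) u" and t: "t \<in> {0..T}"
  shows "((\<lambda>s. dx j (u s) x) has_vector_derivative dx j (dt T u t) x) (at t within {0..T})"
proof -
  let ?a = "axis j 1 :: real ^ 'n"
  have C1: "C_slab T (Suc k) (dt T u)" using C2 by simp
  have c1: "continuous_on ({0..T} \<times> UNIV) (\<lambda>p. dt T u (fst p) (snd p))"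
    by (rule C_slab_continuous[OF C1])
  have c2: "continuous_on ({0..T} \<times> UNIV) (\<lambda>p. dx j (dt T u (fst p)) (snd p))"
    by (rule C_slab_continuous[of T k]) (use C1 in auto)
  have line: "continuous_on A (\<lambda>s. dt T u s y)" "continuous_on A (\<lambda>s. dx j (dt T u s) y)"
    if "A \<subseteq> {0..T}" for A y
    using that
    by (auto intro!: continuous_on_slab_compose[OF c1] continuous_on_slab_compose[OF c2] continuous_on_id
        continuous_on_const)
  have FTC: "u s y = u 0 y + integral {0..s} (\<lambda>r. dt T u r y)" if s: "s \<in> {0..T}" for s y
  proof -
    have "((\<lambda>r. dt T u r y) has_integral (u s y - u 0 y)) {0..s}"
      using s by (intro fundamental_theorem_of_calculus)
        (auto intro!: has_vector_derivative_within_subset[OF C_slab_Suc_has_dt[OF C2]])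
    then show ?thesis by (simp add: integral_unique)
  qed
  have dx_eq: "dx j (u s) x = dx j (u 0) x + integral {0..s} (\<lambda>r. dx j (dt T u r) x)"
    if s: "s \<in> {0..T}" for s
  proof -
    have "((\<lambda>b. integral (cbox 0 s) (\<lambda>r. dt T u r (x + b *\<^sub>R ?a))) has_real_derivative
        integral (cbox 0 s) (\<lambda>r. dx j (dt T u r) (x + 0 *\<^sub>R ?a))) (at 0 within UNIV)"
    proof (rule leibniz_rule_field_derivative[where f = "\<lambda>b r. dt T u r (x + b *\<^sub>R ?a)"
          and fx = "\<lambda>b r. dx j (dt T u r) (x + b *\<^sub>R ?a)"])
      show "((\<lambda>b. dt T u r (x + b *\<^sub>R ?a)) has_real_derivative dx j (dt T u r) (x + b *\<^sub>R ?a)) (at b)"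
        if "r \<in> cbox 0 s" for b r
        using that s
        by (intro has_real_derivative_along_line[OF C_slab_Suc_has_dx[OF C1]]) auto
      show "(\<lambda>r. dt T u r (x + b *\<^sub>R ?a)) integrable_on cbox 0 s" for b
        using s by (intro integrable_continuous line) auto
      show "continuous_on (UNIV \<times> cbox 0 s) (\<lambda>(b, r). dx j (dt T u r) (x + b *\<^sub>R ?a))"
        using s unfolding split_beta
        by (intro continuous_on_slab_compose[OF c2] continuous_on_snd continuous_on_add continuous_on_scaleR
            continuous_on_fst continuous_on_id continuous_on_const) auto
    qed auto
    then have "((\<lambda>b. u 0 (x + b *\<^sub>R ?a) + integral {0..s} (\<lambda>r. dt T u r (x + b *\<^sub>R ?a))) has_real_derivative
        dx j (u 0) x + integral {0..s} (\<lambda>r. dx j (dt T u r) x)) (at 0)"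
      using s by (intro DERIV_add C_slab_Suc_has_dx[OF C2]) auto
    then have "((\<lambda>b. u s (x + b *\<^sub>R ?a)) has_real_derivative
        dx j (u 0) x + integral {0..s} (\<lambda>r. dx j (dt T u r) x)) (at 0)"
      by (simp add: FTC[OF s])
    then show ?thesis unfolding dx_def by (rule DERIV_imp_deriv)
  qed
  have "((\<lambda>s. dx j (u 0) x + integral {0..s} (\<lambda>r. dx j (dt T u r) x)) has_vector_derivative
      0 + dx j (dt T u t) x) (at t within {0..T})"
    using t by (intro has_vector_derivative_add integral_has_vector_derivative line) auto
  then show ?thesis
    using t by (intro has_vector_derivative_transform[OF t dx_eq]) auto
qed

section \<open>The energy density and the multiplier identity\<close>

definition energy_density :: "real \<Rightarrow> real \<Rightarrow> (real \<Rightarrow> real ^ 'n \<Rightarrow> real) \<Rightarrow> real \<Rightarrow> real ^ 'n \<Rightarrow> real"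
  where "energy_density T c u t x = (dt T u t x)\<^sup>2 + c\<^sup>2 * (norm (grad (u t) x))\<^sup>2"

lemma norm_grad_squared: "(norm (grad v x))\<^sup>2 = (\<Sum>j\<in>UNIV. (dx j v x)\<^sup>2)"
  by (simp add: norm_vec_def L2_set_def grad_def sum_nonneg)

lemma continuous_on_slab_section:
  assumes "continuous_on (I \<times> UNIV) (\<lambda>p. A (fst p) (snd p))" "t \<in> I"
  shows "continuous_on B (\<lambda>x. A t x)"
  by (rule continuous_on_slab_compose[OF assms(1) continuous_on_const continuous_on_id]) (rule assms(2))

lemma C_slab_2_continuous:
  assumes "C_slab T 2 u"
  shows "continuous_on ({0..T} \<times> UNIV) (\<lambda>p. dt T u (fst p) (snd p))"
    "continuous_on ({0..T} \<times> UNIV) (\<lambda>p. dx j (u (fst p)) (snd p))"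
    "continuous_on ({0..T} \<times> UNIV) (\<lambda>p. dt T (dt T u) (fst p) (snd p))"
    "continuous_on ({0..T} \<times> UNIV) (\<lambda>p. dx j (dt T u (fst p)) (snd p))"
    "continuous_on ({0..T} \<times> UNIV) (\<lambda>p. dx j (dx j (u (fst p))) (snd p))"
  using assms unfolding numeral_2_eq_2 by (auto simp: case_prod_unfold)

lemma energy_density_continuous:
  assumes "C_slab T 2 u"
  shows "continuous_on ({0..T} \<times> UNIV) (\<lambda>p. energy_density T c u (fst p) (snd p))"
  unfolding energy_density_def norm_grad_squared
  by (intro continuous_intros C_slab_2_continuous[OF assms])

text \<open>\<open>C_slab_has_dt_dx\<close> brings the mixed terms into the form
  \<open>dx j (dt T u)\<close>, in which they later cancel against the divergence of the energy
  flux.\<close>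

lemma energy_density_has_dt:
  assumes C2: "C_slab T 2 u" and t: "t \<in> {0..T}"
  shows "((\<lambda>s. energy_density T c u s x) has_real_derivative
    2 * dt T u t x * dt T (dt T u) t x + 2 * c\<^sup>2 * (\<Sum>j\<in>UNIV. dx j (u t) x * dx j (dt T u t) x))
    (at t within {0..T})"
proof -
  have C2': "C_slab T (Suc (Suc 0)) u" using C2 by (simp add: numeral_2_eq_2)
  then have C1: "C_slab T (Suc 0) (dt T u)" by simp
  have 1: "((\<lambda>s. dt T u s x) has_real_derivative dt T (dt T u) t x) (at t within {0..T})"
    using C_slab_Suc_has_dt[OF C1 t] by (simp add: has_real_derivative_iff_has_vector_derivative)
  have 2: "((\<lambda>s. dx j (u s) x) has_real_derivative dx j (dt T u t) x) (at t within {0..T})" for j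
    using C_slab_has_dt_dx[OF C2' t] by (simp add: has_real_derivative_iff_has_vector_derivative)
  show ?thesis
    unfolding energy_density_def norm_grad_squared
    by (rule derivative_eq_intros 1 2 refl)+ (simp add: sum_distrib_left algebra_simps)
qed

text \<open>By the equation, the time derivative of P times the energy density, minus twice
  \<open>c\<^sup>2\<close> times the divergence of P u_t grad u, equals the integrand on the right.
  Integrated over the slab, the first term leaves the two time slices and the divergence vanishes by
  compact support.\<close>

lemma multiplier_identity:
  fixes u :: "real \<Rightarrow> real ^ 'n \<Rightarrow> real"
  assumes C2: "C_slab T 2 u"
    and wave: "\<And>t x. t \<in> {0..T} \<Longrightarrow> dt T (dt T u) t x - c\<^sup>2 * laplacian (u t) x = F t x"
    and cont: "continuous_on ({0..T} \<times> UNIV) (\<lambda>p. P (fst p) (snd p))"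
      "continuous_on ({0..T} \<times> UNIV) (\<lambda>p. Pt (fst p) (snd p))"
      "\<And>j. continuous_on ({0..T} \<times> UNIV) (\<lambda>p. Px j (fst p) (snd p))"
    and Pt: "\<And>t x. t \<in> {0..T} \<Longrightarrow> ((\<lambda>s. P s x) has_real_derivative Pt t x) (at t within {0..T})"
    and Px: "\<And>t x j. t \<in> {0..T} \<Longrightarrow>
      ((\<lambda>s. P t (x + s *\<^sub>R axis j 1)) has_real_derivative Px j t x) (at 0)"
    and supp: "\<And>t x. t \<in> {0..T} \<Longrightarrow> norm x > K \<Longrightarrow> P t x = 0"
      "\<And>t x j. t \<in> {0..T} \<Longrightarrow> norm x > K \<Longrightarrow> Px j t x = 0"
      "\<And>t x. t \<in> {0..T} \<Longrightarrow> norm x > K \<Longrightarrow> Pt t x = 0"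
    and t: "t \<in> {0..T}"
  shows "(\<integral>x. P t x * energy_density T c u t x \<partial>lborel) - (\<integral>x. P 0 x * energy_density T c u 0 x \<partial>lborel)
    = (\<integral>p. indicator ({0..t} \<times> cball 0 K) p *\<^sub>R
        (2 * P (fst p) (snd p) * dt T u (fst p) (snd p) * F (fst p) (snd p)
         + Pt (fst p) (snd p) * energy_density T c u (fst p) (snd p)
         - 2 * c\<^sup>2 * (\<Sum>j\<in>UNIV. Px j (fst p) (snd p) * dt T u (fst p) (snd p) * dx j (u (fst p)) (snd p))) \<partial>lborel)"
    (is "?L = (\<integral>p. _ *\<^sub>R ?H p \<partial>lborel)")
proof -
  let ?e = "energy_density T c u"
  let ?S = "{0..t} \<times> cball (0 :: real ^ 'n) K"
  note cu = C_slab_2_continuous[OF C2]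
  note ce = energy_density_continuous[OF C2, of c]
  have tT: "0 \<le> t" "t \<le> T" "0 \<in> {0..T}" using t by auto
  define et where "et s x =
    2 * dt T u s x * dt T (dt T u) s x + 2 * c\<^sup>2 * (\<Sum>j\<in>UNIV. dx j (u s) x * dx j (dt T u s) x)" for s x
  \<comment> \<open>\<open>G\<close> is the time derivative of \<open>P\<close> times the energy
    density, and \<open>D j\<close> the \<open>j\<close>-th derivative of the \<open>j\<close>-th
    flux component.\<close>
  define G where "G p = Pt (fst p) (snd p) * ?e (fst p) (snd p) + P (fst p) (snd p) * et (fst p) (snd p)" for p
  define D where "D j p = Px j (fst p) (snd p) * (dt T u (fst p) (snd p) * dx j (u (fst p)) (snd p))
    + P (fst p) (snd p) * (dx j (dt T u (fst p)) (snd p) * dx j (u (fst p)) (snd p)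
      + dt T u (fst p) (snd p) * dx j (dx j (u (fst p))) (snd p))" for j p
  have H: "?H p = G p - 2 * c\<^sup>2 * (\<Sum>j\<in>UNIV. D j p)" if "fst p \<in> {0..T}" for p
  proof -
    have F: "F (fst p) (snd p) =
        dt T (dt T u) (fst p) (snd p) - c\<^sup>2 * (\<Sum>j\<in>UNIV. dx j (dx j (u (fst p))) (snd p))"
      using wave[OF that] by (simp add: laplacian_def)
    show ?thesis
      unfolding F G_def D_def et_def
      by (simp add: algebra_simps sum.distrib sum_distrib_left)
  qed
  have cG: "continuous_on ({0..T} \<times> UNIV) G"
    unfolding G_def et_def by (intro continuous_intros cu ce cont)
  have cD: "continuous_on ({0..T} \<times> UNIV) (D j)" for j
    unfolding D_def by (intro continuous_intros cu ce cont)
  \<comment> \<open>Continuity of \<open>F\<close> is not among the hypotheses; that of the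
    integrand is transferred from the right-hand side of \<open>H\<close>.\<close>
  have cH: "continuous_on ({0..T} \<times> UNIV) ?H"
    by (rule continuous_on_eq[OF _ H[symmetric]])
      (auto intro!: continuous_on_diff continuous_on_mult continuous_on_const continuous_on_sum cG cD)
  have cont_x: "continuous_on B (\<lambda>x. A (s, x))"
    if "continuous_on ({0..T} \<times> UNIV) A" "s \<in> {0..T}" for A :: "real \<times> (real ^ 'n) \<Rightarrow> real" and s B
    by (rule continuous_on_slab_section[of "{0..T}" "\<lambda>s x. A (s, x)"]) (use that in simp_all)
  have "compact ?S" by (intro compact_Times) auto
  have integrable: "integrable (lborel \<Otimes>\<^sub>M lborel) (\<lambda>p. indicator ?S p *\<^sub>R A p)"
    if "continuous_on ({0..T} \<times> UNIV) A" for A :: "real \<times> (real ^ 'n) \<Rightarrow> real"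
    unfolding lborel_prod using tT
    by (intro borel_integrable_compact \<open>compact ?S\<close> continuous_on_subset[OF that]) auto
  have intPe: "integrable lborel (\<lambda>x. P s x * ?e s x)" if "s \<in> {0..T}" for s
    using supp(1)[OF that] that
    by (intro integrable_compact_support[of _ K] continuous_intros
        continuous_on_slab_section[OF ce] continuous_on_slab_section[OF cont(1)]) auto
  have "?L = (\<integral>x. P t x * ?e t x - P 0 x * ?e 0 x \<partial>lborel)"
    using intPe[OF t] intPe[OF tT(3)] by simp
  also have "\<dots> = (\<integral>x. \<integral>s. indicator ?S (s, x) *\<^sub>R G (s, x) \<partial>lborel \<partial>lborel)"
  proof (rule Bochner_Integration.integral_cong[OF refl])
    fix x :: "real ^ 'n"
    show "P t x * ?e t x - P 0 x * ?e 0 x = (\<integral>s. indicator ?S (s, x) *\<^sub>R G (s, x) \<partial>lborel)"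
    proof (cases "norm x \<le> K")
      case True
      have "(\<integral>s. indicator {0..t} s *\<^sub>R G (s, x) \<partial>lborel) = P t x * ?e t x - P 0 x * ?e 0 x"
      proof (rule integral_FTC_atLeastAtMost[OF tT(1)])
        show "continuous_on {0..t} (\<lambda>s. G (s, x))"
          using tT by (intro continuous_on_compose2[OF cG]) (auto intro!: continuous_intros)
        fix s assume s: "0 \<le> s" "s \<le> t"
        have "((\<lambda>s. P s x * ?e s x) has_real_derivative G (s, x)) (at s within {0..T})"
          using s tT unfolding G_def et_def
          by (auto intro!: derivative_eq_intros Pt energy_density_has_dt[OF C2])
        then show "((\<lambda>s. P s x * ?e s x) has_vector_derivative G (s, x)) (at s within {0..t})"
          using tT by (auto simp: has_real_derivative_iff_has_vector_derivative
              intro: has_vector_derivative_within_subset)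
      qed
      moreover have "indicator ?S (s, x) = (indicator {0..t} s :: real)" for s
        using True by (simp add: indicator_def)
      ultimately show ?thesis by simp
    next
      case False
      then show ?thesis
        using supp(1)[of t x] supp(1)[of 0 x] tT by simp
    qed
  qed
  \<comment> \<open>Time was innermost for the fundamental theorem of calculus; space has to be
    innermost for the divergence to integrate to 0 at each fixed time.\<close>
  also have "\<dots> = (\<integral>s. \<integral>x. indicator ?S (s, x) *\<^sub>R G (s, x) \<partial>lborel \<partial>lborel)"
    using lborel_pair.Fubini_integral[of "\<lambda>s x. indicator ?S (s, x) *\<^sub>R G (s, x)"] integrable[OF cG]
    by (simp add: case_prod_unfold)
  also have "\<dots> = (\<integral>s. \<integral>x. indicator ?S (s, x) *\<^sub>R ?H (s, x) \<partial>lborel \<partial>lborel)"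
  proof (rule Bochner_Integration.integral_cong[OF refl])
    fix s :: real
    show "(\<integral>x. indicator ?S (s, x) *\<^sub>R G (s, x) \<partial>lborel) = (\<integral>x. indicator ?S (s, x) *\<^sub>R ?H (s, x) \<partial>lborel)"
    proof (cases "s \<in> {0..t}")
      case True
      then have s: "s \<in> {0..T}" using tT by auto
      have C2': "C_slab T (Suc (Suc 0)) u" using C2 by (simp add: numeral_2_eq_2)
      then have C1: "C_slab T (Suc 0) (dt T u)" "C_slab T (Suc 0) (\<lambda>t. dx j (u t))" for j by auto
      have D0: "D j (s, x) = 0" if "norm x > K" for j x
        using supp[OF s that] by (simp add: D_def)
      have intD: "integrable lborel (\<lambda>x. D j (s, x))" for j
        by (intro integrable_compact_support[of _ K] cont_x[OF cD s] D0)
      have intG: "integrable lborel (\<lambda>x. G (s, x))"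
        using supp[OF s] by (intro integrable_compact_support[of _ K] cont_x[OF cG s]) (auto simp: G_def)
      have zero: "(\<integral>x. D j (s, x) \<partial>lborel) = 0" for j
      proof (rule integral_directional_derivative_eq_0[where a = "axis j 1" and K = K
            and h = "\<lambda>x. P s x * (dt T u s x * dx j (u s) x)"])
        show "continuous_on UNIV (\<lambda>x. P s x * (dt T u s x * dx j (u s) x))"
          by (intro continuous_intros continuous_on_slab_section[OF cont(1) s]
              continuous_on_slab_section[OF cu(1) s] continuous_on_slab_section[OF cu(2) s])
        show "((\<lambda>r. P s (x + r *\<^sub>R axis j 1) * (dt T u s (x + r *\<^sub>R axis j 1) * dx j (u s) (x + r *\<^sub>R axis j 1)))
            has_real_derivative D j (s, x)) (at 0)" for x
          unfolding D_def
          by (rule derivative_eq_intros Px[OF s] C_slab_Suc_has_dx[OF C1(1) s]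
              C_slab_Suc_has_dx[OF C1(2) s] refl)+ (simp add: algebra_simps)
      qed (use supp(1)[OF s] D0 cont_x[OF cD s] in auto)
      have ind: "indicator ?S (s, x) *\<^sub>R A x = A x" if "\<And>x. norm x > K \<Longrightarrow> A x = 0" for A :: "real ^ 'n \<Rightarrow> real" and x
        using True that[of x] by (auto simp: indicator_def not_le)
      have "(\<integral>x. indicator ?S (s, x) *\<^sub>R G (s, x) \<partial>lborel) = (\<integral>x. G (s, x) \<partial>lborel)"
        using supp[OF s] by (intro Bochner_Integration.integral_cong refl ind) (auto simp: G_def)
      also have "\<dots> = (\<integral>x. G (s, x) - 2 * c\<^sup>2 * (\<Sum>j\<in>UNIV. D j (s, x)) \<partial>lborel)"
        using intG intD by (simp add: zero)
      also have "\<dots> = (\<integral>x. ?H (s, x) \<partial>lborel)"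
        using H[of "(s, _)"] s by simp
      also have "\<dots> = (\<integral>x. indicator ?S (s, x) *\<^sub>R ?H (s, x) \<partial>lborel)"
        using supp[OF s] by (intro Bochner_Integration.integral_cong refl ind[symmetric]) auto
      finally show ?thesis .
    qed auto
  qed
  also have "\<dots> = (\<integral>p. indicator ?S p *\<^sub>R ?H p \<partial>(lborel \<Otimes>\<^sub>M lborel))"
    using lborel_pair.integral_fst'[OF integrable[OF cH]] .
  finally show ?thesis unfolding lborel_prod .
qed

section \<open>Null energies and tangential derivatives\<close>

text \<open>For \<open>b = x /\<^sub>R norm x\<close> this is the tangential energy of the outgoing
  cone, for the opposite direction that of the incoming one. The vector \<open>b\<close> is kept
  free because the smoothed radius yields directions of length below 1.\<close>

definition null_energy ::
  "real \<Rightarrow> real \<Rightarrow> (real \<Rightarrow> real ^ 'n \<Rightarrow> real) \<Rightarrow> real ^ 'n \<Rightarrow> real \<Rightarrow> real ^ 'n \<Rightarrow> real"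
  where "null_energy T c u b t x = energy_density T c u t x + 2 * c * dt T u t x * (b \<bullet> grad (u t) x)"

lemma energy_density_nonneg: "0 \<le> energy_density T c u t x"
  by (simp add: energy_density_def)

text \<open>By Cauchy-Schwarz and the inequality between 2ab and the sum of squares, the cross term
  is at most the energy density in absolute value.\<close>

lemma null_energy_bounds:
  assumes "norm b \<le> 1" "c \<ge> 0"
  shows "0 \<le> null_energy T c u b t x" "null_energy T c u b t x \<le> 2 * energy_density T c u t x"
proof -
  have "\<bar>b \<bullet> grad (u t) x\<bar> \<le> norm b * norm (grad (u t) x)" by (rule Cauchy_Schwarz_ineq2)
  also have "\<dots> \<le> norm (grad (u t) x)" using assms by (simp add: mult_left_le_one_le)
  finally have "2 * c * \<bar>dt T u t x\<bar> * \<bar>b \<bullet> grad (u t) x\<bar> \<le> 2 * c * \<bar>dt T u t x\<bar> * norm (grad (u t) x)"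
    using assms(2) by (intro mult_left_mono) auto
  then have "\<bar>2 * c * dt T u t x * (b \<bullet> grad (u t) x)\<bar> \<le> 2 * \<bar>dt T u t x\<bar> * (c * norm (grad (u t) x))"
    using assms(2) by (simp add: abs_mult mult_ac)
  also have "\<dots> \<le> energy_density T c u t x"
    using sum_squares_bound[of "\<bar>dt T u t x\<bar>" "c * norm (grad (u t) x)"]
    by (simp add: energy_density_def power_mult_distrib)
  finally show "0 \<le> null_energy T c u b t x" "null_energy T c u b t x \<le> 2 * energy_density T c u t x"
    unfolding null_energy_def by linarith+
qed

text \<open>The tangential gradient is the part of the gradient orthogonal to x, so by Pythagoras
  the radial squares cancel: (u_t + c u_r)^2 + c^2 (|grad u|^2 - u_r^2) = e + 2 c u_t u_r.\<close>

lemma tang_energy_eq_null_energy: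
  fixes u :: "real \<Rightarrow> real ^ 'n \<Rightarrow> real"
  assumes "x \<noteq> 0"
  shows "tang_energy T c u t x = null_energy T c u (x /\<^sub>R norm x) t x"
proof -
  have dr: "dr (u t) x = (x /\<^sub>R norm x) \<bullet> grad (u t) x"
    by (simp add: dr_def inner_vec_def grad_def sum_divide_distrib field_simps)
  have "(\<Sum>j\<in>UNIV. (tang j u t x)\<^sup>2) = (norm (grad (u t) x))\<^sup>2 - (dr (u t) x)\<^sup>2"
  proof (cases "CARD('n) = 1")
    \<comment> \<open>In dimension one \<open>tang\<close> is 0 by definition, which fits the
      formula because the gradient is purely radial.\<close>
    case True
    then obtain i :: 'n where UNIV: "UNIV = {i}" by (auto simp: card_1_singleton_iff)
    have "norm x = \<bar>x $ i\<bar>" by (simp add: norm_vec_def UNIV)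
    moreover from this have "x $ i \<noteq> 0" using assms by auto
    ultimately have "(norm (grad (u t) x))\<^sup>2 = (dr (u t) x)\<^sup>2"
      by (simp add: dr_def norm_vec_def grad_def UNIV power_divide power_mult_distrib)
    then show ?thesis using True by (simp add: tang_def)
  next
    case False
    let ?b = "x /\<^sub>R norm x"
    have "(\<Sum>j\<in>UNIV. (tang j u t x)\<^sup>2) = (norm (grad (u t) x - dr (u t) x *\<^sub>R ?b))\<^sup>2"
      using False
      by (simp add: tang_def norm_vec_def L2_set_def sum_nonneg grad_def divide_inverse mult_ac)
    also have "\<dots> = (norm (grad (u t) x))\<^sup>2 - 2 * dr (u t) x * (grad (u t) x \<bullet> ?b) + (dr (u t) x)\<^sup>2 * (norm ?b)\<^sup>2"
      unfolding power2_norm_eq_inner by (simp add: inner_diff inner_commute algebra_simps power2_eq_square)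
    also have "norm ?b = 1" using assms by simp
    also have "grad (u t) x \<bullet> ?b = dr (u t) x" unfolding dr by (rule inner_commute)
    finally show ?thesis by (simp add: power2_eq_square)
  qed
  then have "tang_energy T c u t x
      = (dt T u t x + c * dr (u t) x)\<^sup>2 + c\<^sup>2 * ((norm (grad (u t) x))\<^sup>2 - (dr (u t) x)\<^sup>2)"
    unfolding tang_energy_def tang0_def by simp
  then show ?thesis
    unfolding null_energy_def energy_density_def dr[symmetric]
    by (simp add: power2_eq_square algebra_simps)
qed

section \<open>A continuously differentiable truncation and the smoothed radius\<close>

text \<open>Squaring the positive part makes the slopes on both sides of 0 agree, so that the cutoff
  built from it has a continuous derivative.\<close>

lemma max_0_squared_has_derivative:
  fixes y :: real
  shows "((\<lambda>y. (max 0 y)\<^sup>2) has_real_derivative 2 * max 0 y) (at y)"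
proof -
  consider "y < 0" | "y = 0" | "y > 0" by linarith
  then show ?thesis
  proof cases
    case 1
    have "((\<lambda>y. 0) has_real_derivative 2 * max 0 y) (at y)" using 1 by simp
    then show ?thesis
      by (rule has_field_derivative_transform_within_open[of _ _ _ "{..<0}"]) (use 1 in auto)
  next
    case 2
    have "((\<lambda>h. (max 0 h)\<^sup>2 / h) \<longlongrightarrow> 0) (at (0::real))"
    proof (rule Lim_null_comparison)
      show "\<forall>\<^sub>F h in at (0::real). norm ((max 0 h)\<^sup>2 / h) \<le> \<bar>h\<bar>"
        by (intro always_eventually allI) (auto simp: max_def power2_eq_square)
      show "((\<lambda>h. \<bar>h\<bar>) \<longlongrightarrow> 0) (at (0::real))" by (auto intro!: tendsto_eq_intros)
    qed
    then show ?thesis using 2 by (simp add: DERIV_def)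
  next
    case 3
    have "((\<lambda>y. y\<^sup>2) has_real_derivative 2 * max 0 y) (at y)"
      using 3 by (auto intro!: derivative_eq_intros)
    then show ?thesis
      by (rule has_field_derivative_transform_within_open[of _ _ _ "{0<..}"]) (use 3 in auto)
  qed
qed

text \<open>Smoothing the radius at the origin keeps the multipliers below of class \<open>C\<^sup>1\<close>.\<close>

definition smooth_radius :: "real \<Rightarrow> 'a::real_normed_vector \<Rightarrow> real"
  where "smooth_radius e x = sqrt ((norm x)\<^sup>2 + e\<^sup>2)"

lemma norm_le_smooth_radius: "norm x \<le> smooth_radius e x"
  unfolding smooth_radius_def by (rule real_le_rsqrt) simp

lemma smooth_radius_pos: "e > 0 \<Longrightarrow> smooth_radius e x > 0"
  unfolding smooth_radius_def by (simp add: add_nonneg_pos)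

lemma continuous_on_smooth_radius [continuous_intros]:
  "continuous_on S f \<Longrightarrow> continuous_on S (\<lambda>x. smooth_radius e (f x))"
  unfolding smooth_radius_def by (intro continuous_intros)

lemma smooth_radius_has_derivative:
  fixes x :: "real ^ 'n"
  assumes "e > 0"
  shows "((\<lambda>s. smooth_radius e (x + s *\<^sub>R axis j 1)) has_real_derivative x $ j / smooth_radius e x) (at 0)"
proof -
  have eq: "(norm (x + s *\<^sub>R axis j 1))\<^sup>2 = (norm x)\<^sup>2 + 2 * s * x $ j + s\<^sup>2" for s
    unfolding power2_norm_eq_inner
    by (simp add: inner_add inner_axis inner_axis' axis_nth inner_axis_axis power2_eq_square algebra_simps)
  have "((\<lambda>s. (norm x)\<^sup>2 + 2 * s * x $ j + s\<^sup>2 + e\<^sup>2) has_real_derivative 2 * x $ j) (at 0)"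
    by (auto intro!: derivative_eq_intros)
  moreover have "(norm x)\<^sup>2 + 2 * 0 * x $ j + 0\<^sup>2 + e\<^sup>2 > 0"
    using assms by (simp add: add_nonneg_pos)
  ultimately have "((\<lambda>s. sqrt ((norm x)\<^sup>2 + 2 * s * x $ j + s\<^sup>2 + e\<^sup>2)) has_real_derivative
      inverse (sqrt ((norm x)\<^sup>2 + 2 * 0 * x $ j + 0\<^sup>2 + e\<^sup>2)) / 2 * (2 * x $ j)) (at 0)"
    by (intro DERIV_chain2[OF DERIV_real_sqrt])
  then show ?thesis
    unfolding smooth_radius_def eq by (rule DERIV_cong) (simp add: field_simps)
qed

section \<open>Iterated integrals and measurability on the slab\<close>

text \<open>Continuity and compact support give integrability; Tonelli then equates the Bochner
  integral over space-time, in which the multiplier identity is written, with the iterated integrals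
  of the theorem.\<close>

lemma slab_nn_integral_eq:
  fixes A :: "real \<Rightarrow> real ^ 'n \<Rightarrow> real"
  assumes cont: "continuous_on ({0..T} \<times> UNIV) (\<lambda>p. A (fst p) (snd p))"
    and nonneg: "\<And>s x. s \<in> {0..T} \<Longrightarrow> 0 \<le> A s x"
    and supp: "\<And>s x. s \<in> {0..T} \<Longrightarrow> norm x > K \<Longrightarrow> A s x = 0"
    and t: "t \<in> {0..T}"
  shows "integrable lborel (\<lambda>p. indicator ({0..t} \<times> cball 0 K) p *\<^sub>R A (fst p) (snd p))"
    and "(\<integral>\<^sup>+s\<in>{0..t}. (\<integral>\<^sup>+x. ennreal (A s x) \<partial>lborel) \<partial>lborel)
      = ennreal (\<integral>p. indicator ({0..t} \<times> cball 0 K) p *\<^sub>R A (fst p) (snd p) \<partial>lborel)"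
proof -
  let ?f = "\<lambda>p. indicator ({0..t} \<times> cball 0 K) p *\<^sub>R A (fst p) (snd p)"
  show int: "integrable lborel ?f"
    using t by (intro borel_integrable_compact compact_Times continuous_on_subset[OF cont]) auto
  have "(\<integral>\<^sup>+s\<in>{0..t}. (\<integral>\<^sup>+x. ennreal (A s x) \<partial>lborel) \<partial>lborel) = (\<integral>\<^sup>+s. \<integral>\<^sup>+x. ennreal (?f (s, x)) \<partial>lborel \<partial>lborel)"
  proof (intro nn_integral_cong)
    fix s
    show "(\<integral>\<^sup>+x. ennreal (A s x) \<partial>lborel) * indicator {0..t} s = (\<integral>\<^sup>+x. ennreal (?f (s, x)) \<partial>lborel)"
    proof (cases "s \<in> {0..t}")
      case True
      then have "A s x = ?f (s, x)" for x
        using supp[of s x] t by (auto simp: indicator_def not_le)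
      then have "(\<integral>\<^sup>+x. ennreal (A s x) \<partial>lborel) = (\<integral>\<^sup>+x. ennreal (?f (s, x)) \<partial>lborel)"
        by (intro nn_integral_cong arg_cong[of _ _ ennreal])
      then show ?thesis using True by simp
    qed auto
  qed
  also have "\<dots> = (\<integral>\<^sup>+p. ennreal (?f p) \<partial>(lborel \<Otimes>\<^sub>M lborel))"
    using int by (intro lborel.nn_integral_fst) (simp add: lborel_prod)
  also have "\<dots> = ennreal (\<integral>p. ?f p \<partial>lborel)"
    unfolding lborel_prod using t by (intro nn_integral_eq_integral int AE_I2) (auto simp: indicator_def nonneg)
  finally show "(\<integral>\<^sup>+s\<in>{0..t}. (\<integral>\<^sup>+x. ennreal (A s x) \<partial>lborel) \<partial>lborel) = ennreal (\<integral>p. ?f p \<partial>lborel)" .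
qed

text \<open>Integrands are controlled only for times in \<open>{0..T}\<close>, since
  \<open>dt\<close> is taken within that interval; the indicator removes all other times.\<close>

lemma slab_measurable:
  fixes A :: "real \<Rightarrow> real ^ 'n \<Rightarrow> real"
  assumes "continuous_on ({0..T} \<times> UNIV) (\<lambda>p. A (fst p) (snd p))"
  shows "(\<lambda>p. indicator {0..T} (fst p) * A (fst p) (snd p)) \<in> borel_measurable (borel \<Otimes>\<^sub>M borel)"
proof -
  have "(\<lambda>p. indicator ({0..T} \<times> UNIV) p *\<^sub>R A (fst p) (snd p)) \<in> borel_measurable borel"
    by (intro borel_measurable_continuous_on_indicator assms borel_closed closed_Times) auto
  then show ?thesis by (simp add: borel_prod indicator_times)
qed

lemma slab_nn_integral_measurable:
  fixes A :: "real \<Rightarrow> real ^ 'n \<Rightarrow> real"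
  assumes [measurable]: "(\<lambda>p. indicator {0..T} (fst p) * A (fst p) (snd p)) \<in> borel_measurable (borel \<Otimes>\<^sub>M borel)"
  shows "(\<lambda>t. (\<integral>\<^sup>+x. ennreal (A t x) \<partial>lborel) * indicator {0..T} t) \<in> borel_measurable lborel"
proof -
  have "(\<lambda>t. (\<integral>\<^sup>+x. ennreal (A t x) \<partial>lborel) * indicator {0..T} t)
      = (\<lambda>t. \<integral>\<^sup>+x. ennreal (indicator {0..T} (fst (t, x)) * A (fst (t, x)) (snd (t, x))) \<partial>lborel)"
    by (auto simp: fun_eq_iff indicator_def)
  also have "\<dots> \<in> borel_measurable lborel"
    by (rule lborel.borel_measurable_nn_integral_fst[where f = "\<lambda>p. ennreal (indicator {0..T} (fst p) * A (fst p) (snd p))"])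
      (use assms in simp)
  finally show ?thesis .
qed

lemma borel_measurable_ennreal_continuous:
  "continuous_on UNIV f \<Longrightarrow> (\<lambda>x. ennreal (f x)) \<in> borel_measurable lborel"
  by (intro measurable_compose[OF _ measurable_ennreal]) (simp add: borel_measurable_continuous_onI)

lemma source_continuous:
  assumes "C_slab T 2 u"
    and "\<And>t x. t \<in> {0..T} \<Longrightarrow> dt T (dt T u) t x - c\<^sup>2 * laplacian (u t) x = F t x"
  shows "continuous_on ({0..T} \<times> UNIV) (\<lambda>p. F (fst p) (snd p))"
proof (rule continuous_on_eq)
  show "continuous_on ({0..T} \<times> UNIV)
      (\<lambda>p. dt T (dt T u) (fst p) (snd p) - c\<^sup>2 * laplacian (u (fst p)) (snd p))"
    unfolding laplacian_def by (intro continuous_intros C_slab_2_continuous[OF assms(1)])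
qed (use assms(2) in auto)

lemma null_energy_continuous:
  assumes "C_slab T 2 u" "continuous_on ({0..T} \<times> UNIV) b"
  shows "continuous_on ({0..T} \<times> UNIV) (\<lambda>p. null_energy T c u (b p) (fst p) (snd p))"
  unfolding null_energy_def inner_vec_def grad_def inner_real_def vec_lambda_beta
  by (intro continuous_intros C_slab_2_continuous[OF assms(1)] energy_density_continuous[OF assms(1)] assms(2))

section \<open>The estimate for smoothed and truncated weights\<close>

text \<open>This is the factor \<open>\<chi>\<close>: for positive \<open>R\<close> it is
  nonincreasing and vanishes from \<open>R\<close> on, the square makes it continuously
  differentiable, and at each fixed point it tends to 1 as \<open>R\<close> grows.\<close>

definition cutoff :: "real \<Rightarrow> real \<Rightarrow> real"
  where "cutoff R z = (max 0 (1 - z / R))\<^sup>2"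

lemma cutoff_bounds:
  assumes "z \<ge> 0" "R > 0"
  shows "0 \<le> cutoff R z" "cutoff R z \<le> 1"
  using assms by (auto simp: cutoff_def max_def power_le_one)

lemma cutoff_eq_0: "R > 0 \<Longrightarrow> z \<ge> R \<Longrightarrow> cutoff R z = 0"
  by (simp add: cutoff_def max_def field_simps)

lemma cutoff_has_derivative:
  assumes "R > 0"
  shows "(cutoff R has_real_derivative - (2 * max 0 (1 - z / R) / R)) (at z)"
proof -
  have "((\<lambda>z. 1 - z / R) has_real_derivative - (1 / R)) (at z)"
    using assms by (auto intro!: derivative_eq_intros)
  from DERIV_chain2[OF max_0_squared_has_derivative this] show ?thesis
    unfolding cutoff_def[abs_def] by simp
qed

lemma continuous_on_cutoff [continuous_intros]:
  "R > 0 \<Longrightarrow> continuous_on S f \<Longrightarrow> continuous_on S (\<lambda>x. cutoff R (f x))"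
  unfolding cutoff_def by (intro continuous_intros) auto

text \<open>The weight of the overview, with r replaced by the smoothed radius, is the multiplier
  \<open>P\<close>. The replacement only shortens the direction x/r, so both null energies stay
  nonnegative. \<open>phi\<close> is evaluated only below \<open>c * T\<close>, and the factor
  \<open>M\<close> comes from \<open>P \<le> M\<close>.\<close>

lemma weighted_energy_estimate:
  fixes u :: "real \<Rightarrow> real ^ 'n \<Rightarrow> real"
  assumes C2: "C_slab T 2 u"
    and wave: "\<And>t x. t \<in> {0..T} \<Longrightarrow> dt T (dt T u) t x - c\<^sup>2 * laplacian (u t) x = F t x"
    and c: "c > 0" and e: "e > 0" and R: "R > 0"
    and w: "continuous_on UNIV w" "\<And>s. 0 \<le> w s"
    and phi: "\<And>s. s < c * T \<Longrightarrow> (phi has_real_derivative - w s) (at s)"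
      "\<And>s. s < c * T \<Longrightarrow> 0 \<le> phi s" "\<And>s. s < c * T \<Longrightarrow> phi s \<le> M"
    and t: "t \<in> {0..T}"
  shows "(\<integral>\<^sup>+x. ennreal (phi (c * t - smooth_radius e x) * cutoff R (c * t + smooth_radius e x)
            * energy_density T c u t x) \<partial>lborel)
      + (\<integral>\<^sup>+s\<in>{0..t}. (\<integral>\<^sup>+x. ennreal (c * w (c * s - smooth_radius e x)
            * cutoff R (c * s + smooth_radius e x)
            * null_energy T c u (x /\<^sub>R smooth_radius e x) s x) \<partial>lborel) \<partial>lborel)
    \<le> ennreal M * ((\<integral>\<^sup>+x. ennreal (energy_density T c u 0 x) \<partial>lborel)
        + 2 * (\<integral>\<^sup>+s\<in>{0..T}. (\<integral>\<^sup>+x. ennreal \<bar>dt T u s x * F s x\<bar> \<partial>lborel) \<partial>lborel))"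
proof -
  let ?e = "energy_density T c u"
  let ?rho = "smooth_radius e :: real ^ 'n \<Rightarrow> real"
  let ?S = "{0..t} \<times> cball (0 :: real ^ 'n) R"
  define slope where "slope z = 2 * max 0 (1 - z / R) / R" for z
  define P where "P s x = phi (c * s - ?rho x) * cutoff R (c * s + ?rho x)" for s x
  define Pt where "Pt s x = - c * w (c * s - ?rho x) * cutoff R (c * s + ?rho x)
    - c * phi (c * s - ?rho x) * slope (c * s + ?rho x)" for s x
  define Px where "Px j s x = (w (c * s - ?rho x) * cutoff R (c * s + ?rho x)
    - phi (c * s - ?rho x) * slope (c * s + ?rho x)) * (x $ j / ?rho x)" for j s x
  \<comment> \<open>\<open>A\<close> collects the terms with the derivative of \<open>phi\<close>,
    \<open>A'\<close> those with the derivative of \<open>cutoff R\<close>.\<close>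
  define A where "A s x = c * w (c * s - ?rho x) * cutoff R (c * s + ?rho x)
    * null_energy T c u (x /\<^sub>R ?rho x) s x" for s x
  define A' where "A' s x = c * phi (c * s - ?rho x) * slope (c * s + ?rho x)
    * null_energy T c u (- x /\<^sub>R ?rho x) s x" for s x
  define B where "B s x = P s x * \<bar>dt T u s x * F s x\<bar>" for s x
  have rho: "?rho x > 0" "norm x \<le> ?rho x" for x
    by (auto intro: smooth_radius_pos[OF e] norm_le_smooth_radius)
  have dir: "norm (x /\<^sub>R ?rho x) \<le> 1" "norm (- x /\<^sub>R ?rho x) \<le> 1" for x
    using rho[of x] by (auto simp: field_simps)
  \<comment> \<open>Positivity of the smoothed radius makes the first inequality strict and so keeps
    \<open>phi\<close> inside the open half-line where its derivative is known.\<close>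
  have arg: "c * s - ?rho x < c * T" "c * s + ?rho x \<ge> 0" if "s \<in> {0..T}" for s x
  proof -
    have "c * s \<le> c * T" "0 \<le> c * s" using that c by auto
    then show "c * s - ?rho x < c * T" "c * s + ?rho x \<ge> 0" using rho(1)[of x] by linarith+
  qed
  \<comment> \<open>Outside \<open>cball 0 R\<close> the argument of the cutoff is at least
    \<open>R\<close> at every time of the slab, so one ball serves for all times.\<close>
  have far: "cutoff R (c * s + ?rho x) = 0" "slope (c * s + ?rho x) = 0"
    if "s \<in> {0..T}" "norm x > R" for s x
  proof -
    have "c * s + ?rho x \<ge> R" using rho(2)[of x] that c by (simp add: add_increasing)
    then show "cutoff R (c * s + ?rho x) = 0" "slope (c * s + ?rho x) = 0"
      using R by (auto simp: cutoff_eq_0 slope_def max_def field_simps)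
  qed
  have slope: "slope z \<ge> 0" for z using R by (simp add: slope_def)
  have P0: "0 \<le> P s x" "P s x \<le> M" if "s \<in> {0..T}" for s x
  proof -
    note b = cutoff_bounds[OF arg(2)[OF that, of x] R] phi(2,3)[OF arg(1)[OF that, of x]]
    show "0 \<le> P s x" unfolding P_def using b by simp
    have "P s x \<le> phi (c * s - ?rho x)" unfolding P_def using b by (simp add: mult_left_le)
    then show "P s x \<le> M" using b by simp
  qed
  have M: "0 \<le> M" using P0[OF t, of 0] by linarith
  have "continuous_on {..<c * T} phi"
    using phi(1) by (intro continuous_at_imp_continuous_on ballI DERIV_isCont) auto
  then have cphi: "continuous_on ({0..T} \<times> UNIV) (\<lambda>p. phi (c * fst p - ?rho (snd p)))"
    by (rule continuous_on_compose2) (use arg(1) in \<open>auto intro!: continuous_intros\<close>)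
  have cw: "continuous_on ({0..T} \<times> UNIV) (\<lambda>p. w (c * fst p - ?rho (snd p)))"
    by (rule continuous_on_compose2[OF w(1)]) (auto intro!: continuous_intros)
  have cslope: "continuous_on ({0..T} \<times> UNIV) (\<lambda>p. slope (c * fst p + ?rho (snd p)))"
    unfolding slope_def by (intro continuous_intros) (use R in auto)
  have ccut: "continuous_on ({0..T} \<times> UNIV) (\<lambda>p. cutoff R (c * fst p + ?rho (snd p)))"
    by (intro continuous_intros R)
  have rho_neq: "\<forall>p\<in>{0..T} \<times> UNIV. ?rho (snd p) \<noteq> 0" using rho(1) by (metis less_irrefl)
  note cF = source_continuous[OF C2 wave]
  note cu = C_slab_2_continuous[OF C2]
  note ce = energy_density_continuous[OF C2, of c]
  have cP: "continuous_on ({0..T} \<times> UNIV) (\<lambda>p. P (fst p) (snd p))"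
    unfolding P_def by (intro continuous_intros cphi ccut)
  have cB: "continuous_on ({0..T} \<times> UNIV) (\<lambda>p. B (fst p) (snd p))"
    unfolding B_def by (intro continuous_intros cP cu cF)
  have cA: "continuous_on ({0..T} \<times> UNIV) (\<lambda>p. A (fst p) (snd p))"
    unfolding A_def by (intro continuous_intros cw ccut null_energy_continuous[OF C2] rho_neq)
  have cA': "continuous_on ({0..T} \<times> UNIV) (\<lambda>p. A' (fst p) (snd p))"
    unfolding A'_def by (intro continuous_intros cphi cslope null_energy_continuous[OF C2] rho_neq)
  have A0: "0 \<le> A s x" "0 \<le> A' s x" "0 \<le> B s x" if "s \<in> {0..T}" for s x
    unfolding A_def A'_def B_def
    using c w(2) slope P0[OF that] phi(2)[OF arg(1)[OF that, of x]] cutoff_bounds[OF arg(2)[OF that, of x] R]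
      null_energy_bounds(1)[OF dir(1)] null_energy_bounds(1)[OF dir(2)]
    by (auto intro!: mult_nonneg_nonneg)
  have supp: "P s x = 0" "Pt s x = 0" "Px j s x = 0" "A s x = 0" "A' s x = 0" "B s x = 0"
    if "s \<in> {0..T}" "norm x > R" for s x j
    unfolding P_def Pt_def Px_def A_def A'_def B_def using far[OF that] by auto
  let ?H = "\<lambda>p. 2 * P (fst p) (snd p) * dt T u (fst p) (snd p) * F (fst p) (snd p)
         + Pt (fst p) (snd p) * ?e (fst p) (snd p)
         - 2 * c\<^sup>2 * (\<Sum>j\<in>UNIV. Px j (fst p) (snd p) * dt T u (fst p) (snd p) * dx j (u (fst p)) (snd p))"
  have id: "(\<integral>x. P t x * ?e t x \<partial>lborel) - (\<integral>x. P 0 x * ?e 0 x \<partial>lborel)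
      = (\<integral>p. indicator ?S p *\<^sub>R ?H p \<partial>lborel)"
  proof (rule multiplier_identity[OF C2 wave cP _ _ _ _ _ _ _ t])
    show "continuous_on ({0..T} \<times> UNIV) (\<lambda>p. Pt (fst p) (snd p))"
      unfolding Pt_def by (intro continuous_intros cw ccut cphi cslope)
    show "continuous_on ({0..T} \<times> UNIV) (\<lambda>p. Px j (fst p) (snd p))" for j
      unfolding Px_def by (intro continuous_intros cw ccut cphi cslope rho_neq)
    show "((\<lambda>s. P s x) has_real_derivative Pt s x) (at s within {0..T})" if "s \<in> {0..T}" for s x
    proof -
      have 1: "((\<lambda>s. phi (c * s - ?rho x)) has_real_derivative - w (c * s - ?rho x) * (c * 1 - 0)) (at s within {0..T})"
        by (intro DERIV_chain2[of phi] phi(1) arg(1)[OF that] DERIV_diff DERIV_cmult DERIV_ident DERIV_const)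
      have 2: "((\<lambda>s. cutoff R (c * s + ?rho x)) has_real_derivative - slope (c * s + ?rho x) * (c * 1 + 0)) (at s within {0..T})"
        unfolding slope_def
        by (intro DERIV_chain2[of "cutoff R"] cutoff_has_derivative[OF R] DERIV_add DERIV_cmult DERIV_ident DERIV_const)
      show ?thesis
        unfolding P_def Pt_def by (rule DERIV_cong[OF DERIV_mult[OF 1 2]]) (simp add: algebra_simps)
    qed
    show "((\<lambda>r. P s (x + r *\<^sub>R axis j 1)) has_real_derivative Px j s x) (at 0)" if "s \<in> {0..T}" for s x j
    proof -
      have 1: "((\<lambda>r. phi (c * s - ?rho (x + r *\<^sub>R axis j 1))) has_real_derivative
          - w (c * s - ?rho x) * (0 - x $ j / ?rho x)) (at 0)"
        using phi(1)[OF arg(1)[OF that, of x]]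
        by (intro DERIV_chain2[of phi] DERIV_diff DERIV_const smooth_radius_has_derivative[OF e]) simp
      have 2: "((\<lambda>r. cutoff R (c * s + ?rho (x + r *\<^sub>R axis j 1))) has_real_derivative
          - slope (c * s + ?rho x) * (0 + x $ j / ?rho x)) (at 0)"
        using cutoff_has_derivative[OF R, of "c * s + ?rho x"] unfolding slope_def
        by (intro DERIV_chain2[of "cutoff R"] DERIV_add DERIV_const smooth_radius_has_derivative[OF e]) simp
      show ?thesis
        unfolding P_def Px_def by (rule DERIV_cong[OF DERIV_mult[OF 1 2]]) (simp add: algebra_simps)
    qed
  qed (use supp in auto)
  \<comment> \<open>In the chain rule for \<open>Pt\<close> and \<open>Px\<close> the
    \<open>w\<close> parts combine to \<open>- A\<close> with direction
    \<open>x /\<^sub>R ?rho x\<close>, and the \<open>slope\<close> parts, whose spatial sign is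
    reversed, to \<open>- A'\<close> with the opposite direction.\<close>
  have H: "?H p = 2 * P (fst p) (snd p) * dt T u (fst p) (snd p) * F (fst p) (snd p)
      - A (fst p) (snd p) - A' (fst p) (snd p)" for p
  proof -
    obtain s x where p: "p = (s, x)" by (cases p)
    have S: "(\<Sum>j\<in>UNIV. Px j s x * dt T u s x * dx j (u s) x)
        = (w (c * s - ?rho x) * cutoff R (c * s + ?rho x) - phi (c * s - ?rho x) * slope (c * s + ?rho x))
          * dt T u s x * ((x /\<^sub>R ?rho x) \<bullet> grad (u s) x)"
      unfolding Px_def inner_vec_def grad_def sum_distrib_left
      by (intro sum.cong) (simp_all add: divide_inverse mult_ac)
    show ?thesis
      unfolding p fst_conv snd_conv S A_def A'_def Pt_def null_energy_def by (simp add: power2_eq_square algebra_simps)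
  qed
  note nnA = slab_nn_integral_eq[where A = A, OF cA A0(1) supp(4) t]
  note nnB = slab_nn_integral_eq[where A = B, OF cB A0(3) supp(6) t]
  have intPe: "integrable lborel (\<lambda>x. P s x * ?e s x)" if "s \<in> {0..T}" for s
    using supp(1)[OF that]
    by (intro integrable_compact_support[of _ R] continuous_intros
        continuous_on_slab_section[OF ce that] continuous_on_slab_section[OF cP that]) auto
  have nnPe: "(\<integral>\<^sup>+x. ennreal (P s x * ?e s x) \<partial>lborel) = ennreal (\<integral>x. P s x * ?e s x \<partial>lborel)"
    if "s \<in> {0..T}" for s
    by (intro nn_integral_eq_integral intPe that AE_I2 mult_nonneg_nonneg P0 energy_density_nonneg)
  \<comment> \<open>\<open>A'\<close> is nonnegative and is discarded; the source term is bounded by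
    its absolute value.\<close>
  have "(\<integral>p. indicator ?S p *\<^sub>R ?H p \<partial>lborel) \<le>
      (\<integral>p. 2 * (indicator ?S p *\<^sub>R B (fst p) (snd p)) - indicator ?S p *\<^sub>R A (fst p) (snd p) \<partial>lborel)"
  proof (rule integral_mono)
    have "continuous_on ({0..T} \<times> UNIV) ?H"
      unfolding H by (intro continuous_intros cP cA cA' cF cu)
    then show "integrable lborel (\<lambda>p. indicator ?S p *\<^sub>R ?H p)"
      using t by (intro borel_integrable_compact compact_Times) (auto elim: continuous_on_subset)
    show "integrable lborel (\<lambda>p. 2 * (indicator ?S p *\<^sub>R B (fst p) (snd p)) - indicator ?S p *\<^sub>R A (fst p) (snd p))"
      using nnA(1) nnB(1) by simp
    fix p
    show "indicator ?S p *\<^sub>R ?H p \<le> 2 * (indicator ?S p *\<^sub>R B (fst p) (snd p)) - indicator ?S p *\<^sub>R A (fst p) (snd p)"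
    proof (cases "p \<in> ?S")
      case True
      then have s: "fst p \<in> {0..T}" using t by auto
      have "P (fst p) (snd p) * (dt T u (fst p) (snd p) * F (fst p) (snd p)) \<le> B (fst p) (snd p)"
        unfolding B_def by (intro mult_left_mono P0[OF s]) auto
      then show ?thesis using True A0(2)[OF s, of "snd p"] unfolding H by simp
    qed simp
  qed
  then have real: "(\<integral>x. P t x * ?e t x \<partial>lborel) + (\<integral>p. indicator ?S p *\<^sub>R A (fst p) (snd p) \<partial>lborel)
      \<le> (\<integral>x. P 0 x * ?e 0 x \<partial>lborel) + 2 * (\<integral>p. indicator ?S p *\<^sub>R B (fst p) (snd p) \<partial>lborel)"
    using id nnA(1) nnB(1) by simp
  have nonneg: "0 \<le> (\<integral>x. P s x * ?e s x \<partial>lborel)" if "s \<in> {0..T}" for s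
    by (intro integral_nonneg_AE AE_I2 mult_nonneg_nonneg P0 energy_density_nonneg that)
  have nonneg': "0 \<le> (\<integral>p. indicator ?S p *\<^sub>R A (fst p) (snd p) \<partial>lborel)"
    "0 \<le> (\<integral>p. indicator ?S p *\<^sub>R B (fst p) (snd p) \<partial>lborel)"
    using t by (auto intro!: integral_nonneg_AE AE_I2 simp: indicator_def A0)
  have 0: "0 \<in> {0..T}" using t by auto
  have meas: "(\<lambda>x. ennreal (?e 0 x)) \<in> borel_measurable lborel"
    by (intro borel_measurable_ennreal_continuous continuous_on_slab_section[OF ce 0])
  have measF: "(\<lambda>s. (\<integral>\<^sup>+x. ennreal \<bar>dt T u s x * F s x\<bar> \<partial>lborel) * indicator {0..T} s) \<in> borel_measurable lborel"
    by (intro slab_nn_integral_measurable slab_measurable continuous_intros cu cF)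
  have measFx: "(\<lambda>x. ennreal \<bar>dt T u s x * F s x\<bar>) \<in> borel_measurable lborel" if "s \<in> {0..T}" for s
    by (intro borel_measurable_ennreal_continuous continuous_intros
        continuous_on_slab_section[OF cu(1) that] continuous_on_slab_section[OF cF that])
  \<comment> \<open>The inequality \<open>real\<close> has only nonnegative terms and no
    subtraction, so it passes to \<open>ennreal\<close> term by term.\<close>
  have bound: "(\<integral>\<^sup>+x. ennreal (P t x * ?e t x) \<partial>lborel) + (\<integral>\<^sup>+s\<in>{0..t}. (\<integral>\<^sup>+x. ennreal (A s x) \<partial>lborel) \<partial>lborel)
      \<le> (\<integral>\<^sup>+x. ennreal (P 0 x * ?e 0 x) \<partial>lborel) + 2 * (\<integral>\<^sup>+s\<in>{0..t}. (\<integral>\<^sup>+x. ennreal (B s x) \<partial>lborel) \<partial>lborel)"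
  proof -
    have eqA: "(\<integral>\<^sup>+s\<in>{0..t}. (\<integral>\<^sup>+x. ennreal (A s x) \<partial>lborel) \<partial>lborel)
        = ennreal (\<integral>p. indicator ?S p *\<^sub>R A (fst p) (snd p) \<partial>lborel)"
      by (rule nnA(2))
    have eqB: "(\<integral>\<^sup>+s\<in>{0..t}. (\<integral>\<^sup>+x. ennreal (B s x) \<partial>lborel) \<partial>lborel)
        = ennreal (\<integral>p. indicator ?S p *\<^sub>R B (fst p) (snd p) \<partial>lborel)"
      by (rule nnB(2))
    have two: "2 * ennreal r = ennreal (2 * r)" for r by (simp add: ennreal_mult')
    show ?thesis
      unfolding nnPe[OF t] nnPe[OF 0] eqA eqB two
      using ennreal_leI[OF real] nonneg[OF t] nonneg[OF 0] nonneg'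
      by (simp only: ennreal_plus mult_nonneg_nonneg zero_le_numeral)
  qed
  have "(\<integral>\<^sup>+x. ennreal (P 0 x * ?e 0 x) \<partial>lborel) \<le> (\<integral>\<^sup>+x. ennreal M * ennreal (?e 0 x) \<partial>lborel)"
    using M by (intro nn_integral_mono)
      (simp add: ennreal_mult[symmetric] energy_density_nonneg ennreal_leI mult_right_mono P0[OF 0])
  also have "\<dots> = ennreal M * (\<integral>\<^sup>+x. ennreal (?e 0 x) \<partial>lborel)"
    by (rule nn_integral_cmult[OF meas])
  finally have initial: "(\<integral>\<^sup>+x. ennreal (P 0 x * ?e 0 x) \<partial>lborel)
      \<le> ennreal M * (\<integral>\<^sup>+x. ennreal (?e 0 x) \<partial>lborel)" .
  \<comment> \<open>Enlarging \<open>{0..t}\<close> to \<open>{0..T}\<close> makes the bound uniform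
    in \<open>t\<close>.\<close>
  have "(\<integral>\<^sup>+s\<in>{0..t}. (\<integral>\<^sup>+x. ennreal (B s x) \<partial>lborel) \<partial>lborel)
      \<le> (\<integral>\<^sup>+s. ennreal M * ((\<integral>\<^sup>+x. ennreal \<bar>dt T u s x * F s x\<bar> \<partial>lborel) * indicator {0..T} s) \<partial>lborel)"
  proof (intro nn_integral_mono)
    fix s
    show "(\<integral>\<^sup>+x. ennreal (B s x) \<partial>lborel) * indicator {0..t} s
        \<le> ennreal M * ((\<integral>\<^sup>+x. ennreal \<bar>dt T u s x * F s x\<bar> \<partial>lborel) * indicator {0..T} s)"
    proof (cases "s \<in> {0..t}")
      case True
      then have s: "s \<in> {0..T}" using t by auto
      have "(\<integral>\<^sup>+x. ennreal (B s x) \<partial>lborel) \<le> (\<integral>\<^sup>+x. ennreal M * ennreal \<bar>dt T u s x * F s x\<bar> \<partial>lborel)"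
        unfolding B_def using M
        by (intro nn_integral_mono) (simp add: ennreal_mult[symmetric] ennreal_leI mult_right_mono P0[OF s])
      also have "\<dots> = ennreal M * (\<integral>\<^sup>+x. ennreal \<bar>dt T u s x * F s x\<bar> \<partial>lborel)"
        by (rule nn_integral_cmult[OF measFx[OF s]])
      finally show ?thesis using True s by simp
    qed simp
  qed
  also have "\<dots> = ennreal M * (\<integral>\<^sup>+s\<in>{0..T}. (\<integral>\<^sup>+x. ennreal \<bar>dt T u s x * F s x\<bar> \<partial>lborel) \<partial>lborel)"
    by (rule nn_integral_cmult[OF measF])
  finally have source: "(\<integral>\<^sup>+s\<in>{0..t}. (\<integral>\<^sup>+x. ennreal (B s x) \<partial>lborel) \<partial>lborel)
      \<le> ennreal M * (\<integral>\<^sup>+s\<in>{0..T}. (\<integral>\<^sup>+x. ennreal \<bar>dt T u s x * F s x\<bar> \<partial>lborel) \<partial>lborel)" .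
  note order_trans[OF bound add_mono[OF initial mult_left_mono[OF source, of 2]]]
  then show ?thesis
    unfolding P_def A_def by (simp add: distrib_left mult.left_commute[of "2 :: ennreal"])
qed

section \<open>Bounded antiderivatives of even weights\<close>

text \<open>\<open>phi s\<close> is the integral of \<open>w\<close> from \<open>s\<close> to
  \<open>b\<close>, hence nonnegative with derivative \<open>- w\<close>. By evenness it is at most
  twice the mass of \<open>w\<close> on a half-line, which \<open>W\<close> measures.\<close>

lemma even_weight_antiderivative:
  fixes w W :: "real \<Rightarrow> real"
  assumes w: "continuous_on UNIV w" "\<And>s. 0 \<le> w s" "\<And>s. w (- s) = w s"
    and W: "\<And>s. s \<ge> 0 \<Longrightarrow> (W has_real_derivative w s) (at s)" "\<And>s. s \<ge> 0 \<Longrightarrow> W s - W 0 \<le> M / 2"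
  obtains phi where "\<And>s. s < b \<Longrightarrow> (phi has_real_derivative - w s) (at s)"
    "\<And>s. s < b \<Longrightarrow> 0 \<le> phi s" "\<And>s. s < b \<Longrightarrow> phi s \<le> M"
proof
  have cont: "continuous_on A w" for A by (rule continuous_on_subset[OF w(1)]) simp
  have int: "w integrable_on {x..y}" for x y by (intro integrable_continuous_real cont)
  let ?phi = "\<lambda>s. integral {s..b} w"
  fix s assume s: "s < b"
  \<comment> \<open>This left endpoint puts \<open>s\<close> in the interior of
    \<open>{?a..b}\<close>, so the derivative of the integral in its upper limit becomes two-sided;
    subtraction from a constant then makes the lower limit the variable one.\<close>
  let ?a = "s - 1"
  have "((\<lambda>r. integral {?a..r} w) has_real_derivative w s) (at s within {?a..b})"
    using s by (intro integral_has_real_derivative cont) auto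
  then have "((\<lambda>r. integral {?a..r} w) has_real_derivative w s) (at s)"
    using s by (simp add: at_within_Icc_at)
  then have "((\<lambda>r. integral {?a..b} w - integral {?a..r} w) has_real_derivative 0 - w s) (at s)"
    by (intro DERIV_diff DERIV_const)
  then have "((\<lambda>r. integral {?a..b} w - integral {?a..r} w) has_real_derivative - w s) (at s)" by simp
  then show "(?phi has_real_derivative - w s) (at s)"
  proof (rule has_field_derivative_transform_within_open[of _ _ _ "{?a<..<b}"])
    fix r assume "r \<in> {?a<..<b}"
    then show "integral {?a..b} w - integral {?a..r} w = ?phi r"
      using Henstock_Kurzweil_Integration.integral_combine[of ?a r b w] int by simp
  qed (use s in auto)
  show "0 \<le> ?phi s" by (intro integral_nonneg int w(2))
  define N where "N = max \<bar>s\<bar> \<bar>b\<bar>"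
  have N: "N \<ge> 0" "{s..b} \<subseteq> {-N..N}" by (auto simp: N_def)
  have half: "integral {0..N} w = W N - W 0"
    using N(1) by (intro integral_unique fundamental_theorem_of_calculus)
      (auto simp: has_real_derivative_iff_has_vector_derivative[symmetric]
        intro: has_field_derivative_at_within W(1))
  have "?phi s \<le> integral {-N..N} w"
    by (intro integral_subset_le int N) (use w(2) in auto)
  also have "\<dots> = integral {-N..-0} w + integral {0..N} w"
    using Henstock_Kurzweil_Integration.integral_combine[of "-N" 0 N w] int N(1) by simp
  also have "integral {-N..-0} w = integral {0..N} w"
    using Henstock_Kurzweil_Integration.integral_reflect_real[of N 0 w] w(3) by simp
  also have "integral {0..N} w + integral {0..N} w \<le> M"
    using W(2)[OF N(1)] half by simp
  finally show "?phi s \<le> M" .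
qed

section \<open>Removing the smoothing and the truncation\<close>

lemma smooth_radius_tendsto:
  "(\<lambda>k. smooth_radius (1 / real (Suc k)) x) \<longlonglongrightarrow> norm x"
proof -
  have "(\<lambda>k. sqrt ((norm x)\<^sup>2 + (1 / real (Suc k))\<^sup>2)) \<longlonglongrightarrow> sqrt ((norm x)\<^sup>2 + 0\<^sup>2)"
    by (intro tendsto_intros LIMSEQ_Suc[OF lim_1_over_n])
  then show ?thesis by (simp add: smooth_radius_def)
qed

text \<open>At the origin both sides are 0, so convergence holds at every point and no null set
  enters the limits below.\<close>

lemma smooth_direction_tendsto:
  "(\<lambda>k. x /\<^sub>R smooth_radius (1 / real (Suc k)) x) \<longlonglongrightarrow> x /\<^sub>R norm x"
proof (cases "x = 0")
  case False
  then show ?thesis by (intro tendsto_intros smooth_radius_tendsto) simp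
qed simp

lemma cutoff_tendsto_1:
  assumes "z \<longlonglongrightarrow> l"
  shows "(\<lambda>k. cutoff (real (Suc k)) (z k)) \<longlonglongrightarrow> 1"
proof -
  have "(\<lambda>k. (max 0 (1 - z k * (1 / real (Suc k))))\<^sup>2) \<longlonglongrightarrow> (max 0 (1 - l * 0))\<^sup>2"
    by (intro tendsto_intros assms LIMSEQ_Suc[OF lim_1_over_n])
  then show ?thesis by (simp add: cutoff_def)
qed

text \<open>Fatou's lemma; pointwise convergence identifies the lower limit of the integrands with
  \<open>g\<close>.\<close>

lemma nn_integral_le_of_tendsto:
  fixes f :: "nat \<Rightarrow> 'a \<Rightarrow> ennreal"
  assumes "\<And>k. f k \<in> borel_measurable M" "\<And>x. (\<lambda>k. f k x) \<longlonglongrightarrow> g x" "\<And>k. integral\<^sup>N M (f k) \<le> C"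
  shows "integral\<^sup>N M g \<le> C"
proof -
  have "integral\<^sup>N M g = (\<integral>\<^sup>+x. liminf (\<lambda>k. f k x) \<partial>M)"
    by (intro nn_integral_cong lim_imp_Liminf[symmetric] assms(2)) simp
  also have "\<dots> \<le> liminf (\<lambda>k. integral\<^sup>N M (f k))" by (rule nn_integral_liminf[OF assms(1)])
  also have "\<dots> \<le> C" by (rule Liminf_le) (use assms(3) in auto)
  finally show ?thesis .
qed

text \<open>Fatou's lemma on the product space, with the slab's indicator as a factor. Measurability
  of the limit is inherited from the \<open>f k\<close>, and Tonelli uses it to return to the
  iterated integral.\<close>

lemma slab_nn_integral_le_of_tendsto:
  fixes f :: "nat \<Rightarrow> real \<Rightarrow> real ^ 'n \<Rightarrow> real"
  assumes cont: "\<And>k. continuous_on ({0..T} \<times> UNIV) (\<lambda>p. f k (fst p) (snd p))"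
    and lim: "\<And>t x. t \<in> {0..T} \<Longrightarrow> (\<lambda>k. f k t x) \<longlonglongrightarrow> g t x"
    and le: "\<And>k. (\<integral>\<^sup>+t\<in>{0..T}. (\<integral>\<^sup>+x. ennreal (f k t x) \<partial>lborel) \<partial>lborel) \<le> C"
  shows "(\<integral>\<^sup>+t\<in>{0..T}. (\<integral>\<^sup>+x. ennreal (g t x) \<partial>lborel) \<partial>lborel) \<le> C"
proof -
  let ?f = "\<lambda>k p. ennreal (indicator {0..T} (fst p) * f k (fst p) (snd p))"
  let ?g = "\<lambda>p. ennreal (indicator {0..T} (fst p) * g (fst p) (snd p))"
  have meas: "?f k \<in> borel_measurable (lborel \<Otimes>\<^sub>M lborel)" for k
    using slab_measurable[OF cont[of k]] by simp
  have tendsto: "(\<lambda>k. ?f k p) \<longlonglongrightarrow> ?g p" for p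
    using lim[of "fst p" "snd p"] by (cases "fst p \<in> {0..T}") (auto intro!: tendsto_ennrealI)
  have slab: "(\<integral>\<^sup>+t\<in>{0..T}. (\<integral>\<^sup>+x. ennreal (h t x) \<partial>lborel) \<partial>lborel)
      = (\<integral>\<^sup>+p. ennreal (indicator {0..T} (fst p) * h (fst p) (snd p)) \<partial>(lborel \<Otimes>\<^sub>M lborel))"
    if "(\<lambda>p. ennreal (indicator {0..T} (fst p) * h (fst p) (snd p))) \<in> borel_measurable (lborel \<Otimes>\<^sub>M lborel)"
    for h :: "real \<Rightarrow> real ^ 'n \<Rightarrow> real"
    by (subst lborel.nn_integral_fst[OF that, symmetric]) (auto intro!: nn_integral_cong simp: indicator_def)
  have "?g \<in> borel_measurable (lborel \<Otimes>\<^sub>M lborel)"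
    by (rule borel_measurable_LIMSEQ_order[OF tendsto meas])
  moreover have "integral\<^sup>N (lborel \<Otimes>\<^sub>M lborel) ?g \<le> C"
    by (rule nn_integral_le_of_tendsto[OF meas tendsto]) (use le slab[OF meas] in simp)
  ultimately show ?thesis using slab by simp
qed

section \<open>Energy bounds for the limiting weights\<close>

text \<open>The right-hand side of the theorem, with the Cauchy data read off from \<open>u\<close>
  at time 0.\<close>

definition data_bound ::
  "real \<Rightarrow> real \<Rightarrow> (real \<Rightarrow> real ^ 'n \<Rightarrow> real) \<Rightarrow> (real \<Rightarrow> real ^ 'n \<Rightarrow> real) \<Rightarrow> ennreal"
  where "data_bound T c u F = (\<integral>\<^sup>+x. ennreal (energy_density T c u 0 x) \<partial>lborel)
        + 2 * (\<integral>\<^sup>+s\<in>{0..T}. (\<integral>\<^sup>+x. ennreal \<bar>dt T u s x * F s x\<bar> \<partial>lborel) \<partial>lborel)"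

text \<open>The space-time integral of the tangential energy is made a functional of the weight, so
  that weights can be scaled, added and compared.\<close>

definition weighted_null_energy ::
  "real \<Rightarrow> real \<Rightarrow> (real \<Rightarrow> real ^ 'n \<Rightarrow> real) \<Rightarrow> (real \<Rightarrow> real) \<Rightarrow> ennreal"
  where "weighted_null_energy T c u w = (\<integral>\<^sup>+s\<in>{0..T}. (\<integral>\<^sup>+x. ennreal (w (c * s - norm x)
    * null_energy T c u (x /\<^sub>R norm x) s x) \<partial>lborel) \<partial>lborel)"

text \<open>The constant \<open>phi\<close> equal to 1 has \<open>w\<close> equal to 0, which
  removes the space-time term and leaves the energy at time \<open>t\<close>. One index drives both
  limits: the smoothing shrinks like \<open>1 / real (Suc k)\<close> while the cutoff radius is
  \<open>real (Suc k)\<close>.\<close>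

lemma energy_bound:
  assumes C2: "C_slab T 2 u"
    and wave: "\<And>t x. t \<in> {0..T} \<Longrightarrow> dt T (dt T u) t x - c\<^sup>2 * laplacian (u t) x = F t x"
    and c: "c > 0"
    and t: "t \<in> {0..T}"
  shows "(\<integral>\<^sup>+x. ennreal (energy_density T c u t x) \<partial>lborel) \<le> data_bound T c u F"
proof (rule nn_integral_le_of_tendsto)
  let ?f = "\<lambda>k x. cutoff (real (Suc k)) (c * t + smooth_radius (1 / real (Suc k)) x) * energy_density T c u t x"
  fix k x
  show "(\<lambda>x. ennreal (?f k x)) \<in> borel_measurable lborel"
    by (intro borel_measurable_ennreal_continuous continuous_intros
        continuous_on_slab_section[OF energy_density_continuous[OF C2] t]) simp
  have "(\<lambda>k. ?f k x) \<longlonglongrightarrow> 1 * energy_density T c u t x"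
    by (intro tendsto_mult tendsto_const cutoff_tendsto_1[of _ "c * t + norm x"] tendsto_add smooth_radius_tendsto)
  then show "(\<lambda>k. ennreal (?f k x)) \<longlonglongrightarrow> ennreal (energy_density T c u t x)"
    by (auto intro: tendsto_ennrealI)
  show "(\<integral>\<^sup>+x. ennreal (?f k x) \<partial>lborel) \<le> data_bound T c u F"
    using weighted_energy_estimate[OF C2 wave c _ _ _ _ _ _ _ t, of "1 / real (Suc k)" "real (Suc k)" "\<lambda>_. 0" "\<lambda>_. 1" 1]
    by (simp add: data_bound_def)
qed

text \<open>Here \<open>weighted_energy_estimate\<close> is used at time \<open>T\<close>, its
  energy term at that time is dropped, and the double limit is taken by Fatou's lemma.\<close>

lemma weighted_null_energy_bound:
  fixes u :: "real \<Rightarrow> real ^ 'n \<Rightarrow> real"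
  assumes C2: "C_slab T 2 u"
    and wave: "\<And>t x. t \<in> {0..T} \<Longrightarrow> dt T (dt T u) t x - c\<^sup>2 * laplacian (u t) x = F t x"
    and c: "c > 0"
    and T: "T > 0"
    and w: "continuous_on UNIV w" "\<And>s. 0 \<le> w s"
    and phi: "\<And>s. s < c * T \<Longrightarrow> (phi has_real_derivative - w s) (at s)"
      "\<And>s. s < c * T \<Longrightarrow> 0 \<le> phi s" "\<And>s. s < c * T \<Longrightarrow> phi s \<le> M"
  shows "weighted_null_energy T c u (\<lambda>s. c * w s) \<le> ennreal M * data_bound T c u F"
  unfolding weighted_null_energy_def
proof (rule slab_nn_integral_le_of_tendsto)
  let ?rho = "\<lambda>k. smooth_radius (1 / real (Suc k)) :: real ^ 'n \<Rightarrow> real"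
  let ?f = "\<lambda>k s x. c * w (c * s - ?rho k x) * cutoff (real (Suc k)) (c * s + ?rho k x)
    * null_energy T c u (x /\<^sub>R ?rho k x) s x"
  fix k
  have "?rho k x \<noteq> 0" for x :: "real ^ 'n" using smooth_radius_pos[of "1 / real (Suc k)" x] by simp
  then show "continuous_on ({0..T} \<times> UNIV) (\<lambda>p. ?f k (fst p) (snd p))"
    by (intro continuous_intros null_energy_continuous[OF C2] continuous_on_compose2[OF w(1)]) auto
  show "(\<integral>\<^sup>+s\<in>{0..T}. (\<integral>\<^sup>+x. ennreal (?f k s x) \<partial>lborel) \<partial>lborel) \<le> ennreal M * data_bound T c u F"
    unfolding data_bound_def
    by (rule order_trans[OF _ weighted_energy_estimate[OF C2 wave c _ _ w phi, of "1 / real (Suc k)" "real (Suc k)" T]])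
      (use T in auto)
next
  let ?rho = "\<lambda>k. smooth_radius (1 / real (Suc k)) :: real ^ 'n \<Rightarrow> real"
  fix s and x :: "real ^ 'n"
  have "isCont w (c * s - norm x)" using w(1) by (simp add: continuous_on_eq_continuous_at)
  then have "(\<lambda>k. w (c * s - ?rho k x)) \<longlonglongrightarrow> w (c * s - norm x)"
    by (rule isCont_tendsto_compose) (intro tendsto_intros smooth_radius_tendsto)
  then have "(\<lambda>k. c * w (c * s - ?rho k x) * cutoff (real (Suc k)) (c * s + ?rho k x)
      * null_energy T c u (x /\<^sub>R ?rho k x) s x)
      \<longlonglongrightarrow> c * w (c * s - norm x) * 1 * null_energy T c u (x /\<^sub>R norm x) s x"
    unfolding null_energy_def
    by (intro tendsto_intros cutoff_tendsto_1[of _ "c * s + norm x"] smooth_radius_tendsto smooth_direction_tendsto)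
  then show "(\<lambda>k. c * w (c * s - ?rho k x) * cutoff (real (Suc k)) (c * s + ?rho k x)
      * null_energy T c u (x /\<^sub>R ?rho k x) s x)
      \<longlonglongrightarrow> c * w (c * s - norm x) * null_energy T c u (x /\<^sub>R norm x) s x"
    by simp
qed

section \<open>Dependence of the null energy on the weight\<close>

lemma null_energy_integrand_measurable:
  fixes u :: "real \<Rightarrow> real ^ 'n \<Rightarrow> real"
  assumes C2: "C_slab T 2 u"
    and w: "continuous_on UNIV w"
  shows "(\<lambda>p. indicator {0..T} (fst p) * (w (c * fst p - norm (snd p))
      * null_energy T c u (snd p /\<^sub>R norm (snd p)) (fst p) (snd p))) \<in> borel_measurable (borel \<Otimes>\<^sub>M borel)"
proof -
  have [measurable]: "w \<in> borel_measurable borel" using w by (rule borel_measurable_continuous_onI)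
  have [measurable]: "(\<lambda>x :: real ^ 'n. x $ j) \<in> borel_measurable borel" for j
    by (intro borel_measurable_continuous_onI continuous_intros)
  have combine: "(\<lambda>p. w (c * fst p - norm (snd p)) * (E p
      + 2 * c * D p * (\<Sum>j\<in>UNIV. snd p $ j / norm (snd p) * G j p))) \<in> borel_measurable (borel \<Otimes>\<^sub>M borel)"
    if [measurable]: "E \<in> borel_measurable (borel \<Otimes>\<^sub>M borel)" "D \<in> borel_measurable (borel \<Otimes>\<^sub>M borel)"
      "\<And>j. G j \<in> borel_measurable (borel \<Otimes>\<^sub>M borel)" for E D and G :: "'n \<Rightarrow> real \<times> (real ^ 'n) \<Rightarrow> real"
    by measurable
  have "(\<lambda>p. indicator {0..T} (fst p) * (w (c * fst p - norm (snd p))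
      * null_energy T c u (snd p /\<^sub>R norm (snd p)) (fst p) (snd p)))
    = (\<lambda>p. w (c * fst p - norm (snd p)) * (indicator {0..T} (fst p) * energy_density T c u (fst p) (snd p)
      + 2 * c * (indicator {0..T} (fst p) * dt T u (fst p) (snd p)) * (\<Sum>j\<in>UNIV. snd p $ j / norm (snd p)
         * (indicator {0..T} (fst p) * dx j (u (fst p)) (snd p)))))"
    by (auto simp: fun_eq_iff null_energy_def inner_vec_def grad_def indicator_def divide_inverse mult_ac)
  also have "\<dots> \<in> borel_measurable (borel \<Otimes>\<^sub>M borel)"
    by (intro combine slab_measurable energy_density_continuous[OF C2] C_slab_2_continuous[OF C2])
  finally show ?thesis .
qed

lemma weighted_null_energy_section_measurable:
  assumes C2: "C_slab T 2 u"
    and w: "continuous_on UNIV w" and s: "s \<in> {0..T}"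
  shows "(\<lambda>x. ennreal (w (c * s - norm x) * null_energy T c u (x /\<^sub>R norm x) s x)) \<in> borel_measurable lborel"
  using measurable_compose[OF measurable_Pair1'[of s borel borel] null_energy_integrand_measurable[OF C2 w]] s
  by simp

lemma norm_direction_le_1: "norm (x /\<^sub>R norm x) \<le> 1" for x :: "'a::real_normed_vector"
  by (cases "x = 0") auto

lemma null_energy_direction_nonneg:
  assumes c: "c > 0"
  shows "0 \<le> null_energy T c u (x /\<^sub>R norm x) s x"
  using c by (intro null_energy_bounds norm_direction_le_1) auto

lemma weighted_null_energy_cmult:
  assumes C2: "C_slab T 2 u"
    and c: "c > 0"
    and w: "continuous_on UNIV w" and a: "a \<ge> 0" and nonneg: "\<And>s. 0 \<le> w s"
  shows "weighted_null_energy T c u (\<lambda>s. a * w s) = ennreal a * weighted_null_energy T c u w"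
proof -
  have "weighted_null_energy T c u (\<lambda>s. a * w s) = (\<integral>\<^sup>+s. ennreal a * ((\<integral>\<^sup>+x. ennreal (w (c * s - norm x)
    * null_energy T c u (x /\<^sub>R norm x) s x) \<partial>lborel) * indicator {0..T} s) \<partial>lborel)"
    unfolding weighted_null_energy_def
  proof (intro nn_integral_cong)
    fix s
    show "(\<integral>\<^sup>+x. ennreal (a * w (c * s - norm x) * null_energy T c u (x /\<^sub>R norm x) s x) \<partial>lborel) * indicator {0..T} s
      = ennreal a * ((\<integral>\<^sup>+x. ennreal (w (c * s - norm x) * null_energy T c u (x /\<^sub>R norm x) s x) \<partial>lborel) * indicator {0..T} s)"
      using weighted_null_energy_section_measurable[OF C2 w, where s = s and c = c] a nonneg null_energy_direction_nonneg[OF c, where T = T and u = u]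
      by (cases "s \<in> {0..T}") (auto simp: nn_integral_cmult[symmetric] ennreal_mult[symmetric] mult.assoc)
  qed
  also have "\<dots> = ennreal a * weighted_null_energy T c u w"
    unfolding weighted_null_energy_def
    by (rule nn_integral_cmult[OF slab_nn_integral_measurable[OF null_energy_integrand_measurable[OF C2 w]]])
  finally show ?thesis .
qed

lemma weighted_null_energy_add:
  assumes C2: "C_slab T 2 u"
    and c: "c > 0"
    and v: "continuous_on UNIV v" "\<And>s. 0 \<le> v s" and w: "continuous_on UNIV w" "\<And>s. 0 \<le> w s"
  shows "weighted_null_energy T c u (\<lambda>s. v s + w s) = weighted_null_energy T c u v + weighted_null_energy T c u w"
proof -
  let ?I = "\<lambda>w s. (\<integral>\<^sup>+x. ennreal (w (c * s - norm x) * null_energy T c u (x /\<^sub>R norm x) s x) \<partial>lborel)"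
  have "weighted_null_energy T c u (\<lambda>s. v s + w s) = (\<integral>\<^sup>+s. ?I v s * indicator {0..T} s + ?I w s * indicator {0..T} s \<partial>lborel)"
    unfolding weighted_null_energy_def
  proof (intro nn_integral_cong)
    fix s
    show "?I (\<lambda>s. v s + w s) s * indicator {0..T} s = ?I v s * indicator {0..T} s + ?I w s * indicator {0..T} s"
      using weighted_null_energy_section_measurable[OF C2 v(1), where s = s and c = c]
        weighted_null_energy_section_measurable[OF C2 w(1), where s = s and c = c] v(2) w(2) null_energy_direction_nonneg[OF c, where T = T and u = u]
      by (cases "s \<in> {0..T}") (auto simp: nn_integral_add[symmetric] ennreal_plus[symmetric] distrib_right
          simp del: ennreal_plus)
  qed
  also have "\<dots> = weighted_null_energy T c u v + weighted_null_energy T c u w"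
    unfolding weighted_null_energy_def
    by (intro nn_integral_add slab_nn_integral_measurable null_energy_integrand_measurable C2 v(1) w(1))
  finally show ?thesis .
qed

lemma weighted_null_energy_mono:
  assumes c: "c > 0"
    and le: "\<And>s. v s \<le> w s"
  shows "weighted_null_energy T c u v \<le> weighted_null_energy T c u w"
  unfolding weighted_null_energy_def
  by (intro nn_integral_mono mult_right_mono ennreal_leI le null_energy_direction_nonneg[OF c]) auto

text \<open>The null energy is at most twice the energy density; integrating the uniform energy
  bound over a time interval of length \<open>T\<close> gives \<open>2 * T\<close>.\<close>

lemma null_energy_total_bound:
  assumes C2: "C_slab T 2 u"
    and wave: "\<And>t x. t \<in> {0..T} \<Longrightarrow> dt T (dt T u) t x - c\<^sup>2 * laplacian (u t) x = F t x"
    and c: "c > 0"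
    and T: "T > 0"
  shows "weighted_null_energy T c u (\<lambda>_. 1) \<le> ennreal (2 * T) * data_bound T c u F"
proof -
  have "weighted_null_energy T c u (\<lambda>_. 1) \<le> (\<integral>\<^sup>+s. 2 * data_bound T c u F * indicator {0..T} s \<partial>lborel)"
    unfolding weighted_null_energy_def
  proof (intro nn_integral_mono)
    fix s
    show "(\<integral>\<^sup>+x. ennreal (1 * null_energy T c u (x /\<^sub>R norm x) s x) \<partial>lborel) * indicator {0..T} s
        \<le> 2 * data_bound T c u F * indicator {0..T} s"
    proof (cases "s \<in> {0..T}")
      case True
      have "(\<integral>\<^sup>+x. ennreal (1 * null_energy T c u (x /\<^sub>R norm x) s x) \<partial>lborel)
          \<le> (\<integral>\<^sup>+x. 2 * ennreal (energy_density T c u s x) \<partial>lborel)"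
      proof (intro nn_integral_mono)
        fix x
        have "null_energy T c u (x /\<^sub>R norm x) s x \<le> 2 * energy_density T c u s x"
          using c by (intro null_energy_bounds norm_direction_le_1) auto
        then have "ennreal (null_energy T c u (x /\<^sub>R norm x) s x) \<le> ennreal (2 * energy_density T c u s x)"
          by (rule ennreal_leI)
        then show "ennreal (1 * null_energy T c u (x /\<^sub>R norm x) s x) \<le> 2 * ennreal (energy_density T c u s x)"
          by (simp add: ennreal_mult' )
      qed
      also have "\<dots> = 2 * (\<integral>\<^sup>+x. ennreal (energy_density T c u s x) \<partial>lborel)"
        by (intro nn_integral_cmult borel_measurable_ennreal_continuous
            continuous_on_slab_section[OF energy_density_continuous[OF C2] True])
      also have "\<dots> \<le> 2 * data_bound T c u F" by (intro mult_left_mono energy_bound[OF C2 wave c] True) auto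
      finally show ?thesis using True by simp
    qed simp
  qed
  also have "\<dots> = 2 * data_bound T c u F * ennreal T" using T by (simp add: nn_integral_cmult_indicator)
  also have "\<dots> = ennreal (2 * T) * data_bound T c u F" using T by (simp add: ennreal_mult' mult_ac)
  finally show ?thesis .
qed

text \<open>This is the form in which concrete weights enter: a primitive \<open>W\<close> on the
  nonnegative half-line certifies that \<open>M\<close> bounds the total mass of
  \<open>w\<close>.\<close>

lemma weighted_null_energy_even:
  assumes C2: "C_slab T 2 u"
    and wave: "\<And>t x. t \<in> {0..T} \<Longrightarrow> dt T (dt T u) t x - c\<^sup>2 * laplacian (u t) x = F t x"
    and c: "c > 0"
    and T: "T > 0"
    and w: "continuous_on UNIV w" "\<And>s. 0 \<le> w s" "\<And>s. w (- s) = w s"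
    and W: "\<And>s. s \<ge> 0 \<Longrightarrow> (W has_real_derivative w s) (at s)" "\<And>s. s \<ge> 0 \<Longrightarrow> W s - W 0 \<le> M / 2"
  shows "ennreal c * weighted_null_energy T c u w \<le> ennreal M * data_bound T c u F"
proof -
  obtain phi where phi: "\<And>s. s < c * T \<Longrightarrow> (phi has_real_derivative - w s) (at s)"
    "\<And>s. s < c * T \<Longrightarrow> 0 \<le> phi s" "\<And>s. s < c * T \<Longrightarrow> phi s \<le> M"
    using even_weight_antiderivative[where b = "c * T", OF w W] by blast
  show ?thesis
    using weighted_null_energy_bound[OF C2 wave c T w(1,2) phi] weighted_null_energy_cmult[OF C2 c w(1) _ w(2), of c] c by simp
qed

text \<open>The two integrands can differ only at the origin, a null set, where
  \<open>tang_energy\<close> involves division by zero.\<close>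

lemma weighted_tang_energy_eq:
  "(\<integral>\<^sup>+t\<in>{0..T}. (\<integral>\<^sup>+x. ennreal (w (c * t - norm x) * tang_energy T c u t x) \<partial>lborel) \<partial>lborel)
    = weighted_null_energy T c u w"
  unfolding weighted_null_energy_def
proof (intro nn_integral_cong)
  fix t
  have "AE x in lborel. ennreal (w (c * t - norm x) * tang_energy T c u t x)
      = ennreal (w (c * t - norm x) * null_energy T c u (x /\<^sub>R norm x) t x)"
    using AE_lborel_singleton[of 0] by eventually_elim (simp add: tang_energy_eq_null_energy)
  then show "(\<integral>\<^sup>+x. ennreal (w (c * t - norm x) * tang_energy T c u t x) \<partial>lborel) * indicator {0..T} t
      = (\<integral>\<^sup>+x. ennreal (w (c * t - norm x) * null_energy T c u (x /\<^sub>R norm x) t x) \<partial>lborel) * indicator {0..T} t"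
    by (simp only: nn_integral_cong_AE)
qed

lemma ennreal_scaled_le:
  assumes "ennreal c * X \<le> ennreal M * D" "c \<ge> 0" "a \<ge> 0" "a * M \<le> 1"
  shows "ennreal (c * a) * X \<le> D"
proof -
  have "ennreal (c * a) * X = ennreal a * (ennreal c * X)"
    using assms by (simp add: ennreal_mult mult_ac)
  also have "\<dots> \<le> ennreal a * (ennreal M * D)" by (intro mult_left_mono assms) simp
  also have "\<dots> = ennreal (a * M) * D" by (simp only: ennreal_mult'[OF assms(3)] mult.assoc)
  also have "\<dots> \<le> 1 * D" using assms(4) by (intro mult_right_mono) (auto simp: ennreal_le_1)
  finally show ?thesis by simp
qed

section \<open>The power weight and the logarithmic weight\<close>

text \<open>The weight has mass \<open>1 / k\<close> on the half-line, hence total mass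
  \<open>2 / k\<close>, which the factor \<open>k / 4\<close> turns into 1/2.\<close>

lemma power_weight_bound:
  fixes u :: "real \<Rightarrow> real ^ 'n \<Rightarrow> real"
  assumes C2: "C_slab T 2 u"
    and wave: "\<And>t x. t \<in> {0..T} \<Longrightarrow> dt T (dt T u) t x - c\<^sup>2 * laplacian (u t) x = F t x"
    and c: "c > 0" and T: "T > 0" and k: "k > 0"
  shows "ennreal (c * (k / 4)) * weighted_null_energy T c u (\<lambda>s. 1 / (1 + \<bar>s\<bar>) powr (1 + k)) \<le> data_bound T c u F"
proof (rule ennreal_scaled_le)
  show "ennreal c * weighted_null_energy T c u (\<lambda>s. 1 / (1 + \<bar>s\<bar>) powr (1 + k)) \<le> ennreal (2 / k) * data_bound T c u F"
  proof (rule weighted_null_energy_even[OF C2 wave c T, where W = "\<lambda>s. - ((1 + s) powr (- k)) / k"])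
    show "continuous_on UNIV (\<lambda>s::real. 1 / (1 + \<bar>s\<bar>) powr (1 + k))"
      by (intro continuous_intros) (auto simp: powr_eq_0_iff)
    fix s :: real assume s: "s \<ge> 0"
    have "((\<lambda>s. - ((1 + s) powr (- k)) / k) has_real_derivative (1 + s) powr (- k - 1)) (at s)"
      using s k by (auto intro!: derivative_eq_intros simp: field_simps)
    also have "- k - 1 = - (1 + k)" by simp
    also have "(1 + s) powr - (1 + k) = 1 / (1 + \<bar>s\<bar>) powr (1 + k)"
      by (simp only: powr_minus_divide abs_of_nonneg[OF s])
    finally show "((\<lambda>s. - ((1 + s) powr (- k)) / k) has_real_derivative 1 / (1 + \<bar>s\<bar>) powr (1 + k)) (at s)" .
    show "- ((1 + s) powr - k) / k - - ((1 + 0) powr - k) / k \<le> 2 / k / 2"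
      using k by (simp add: field_simps)
  qed auto
qed (use c k in auto)

text \<open>The mass of \<open>w\<close> contributes \<open>2 * (ln Y + 1)\<close> and the error
  \<open>1 / Y\<close> contributes 2; six logarithms dominate the sum.\<close>

lemma log_weight_bound:
  fixes u :: "real \<Rightarrow> real ^ 'n \<Rightarrow> real"
  assumes C2: "C_slab T 2 u"
    and wave: "\<And>t x. t \<in> {0..T} \<Longrightarrow> dt T (dt T u) t x - c\<^sup>2 * laplacian (u t) x = F t x"
    and c: "c > 0" and T: "T > 0"
  shows "ennreal (c * (1 / (6 * ln (exp 1 + c * T)))) * weighted_null_energy T c u (\<lambda>s. 1 / (1 + \<bar>s\<bar>))
    \<le> data_bound T c u F"
proof (rule ennreal_scaled_le)
  define Y where "Y = 1 + c * T"
  define w where "w s = Y / ((1 + \<bar>s\<bar>) * (Y + \<bar>s\<bar>))" for s :: real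
  let ?X = "weighted_null_energy T c u"
  let ?D = "data_bound T c u F"
  have Y: "Y > 1" using c T by (simp add: Y_def)
  have cw: "continuous_on UNIV w"
    unfolding w_def using Y by (intro continuous_intros) (auto simp: add_nonneg_eq_0_iff)
  have w0: "0 \<le> w s" for s unfolding w_def using Y by simp
  \<comment> \<open>\<open>W\<close> comes from partial fractions: for nonnegative \<open>s\<close>,
    \<open>w s\<close> is \<open>Y / (Y - 1)\<close> times the difference of
    \<open>1 / (1 + s)\<close> and \<open>1 / (Y + s)\<close>.\<close>
  have X_w: "ennreal c * ?X w \<le> ennreal (2 * (ln Y + 1)) * ?D"
  proof (rule weighted_null_energy_even[OF C2 wave c T cw w0,
        where W = "\<lambda>s. Y / (Y - 1) * (ln (1 + s) - ln (Y + s))"])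
    fix s :: real
    show "w (- s) = w s" by (simp add: w_def)
    assume s: "s \<ge> 0"
    have "((\<lambda>s. Y / (Y - 1) * (ln (1 + s) - ln (Y + s))) has_real_derivative
        Y / (Y - 1) * (1 / (1 + s) - 1 / (Y + s))) (at s)"
      using s Y by (auto intro!: derivative_eq_intros)
    also have "Y / (Y - 1) * (1 / (1 + s) - 1 / (Y + s)) = w s"
      using s Y by (simp add: w_def divide_simps)
    finally show "((\<lambda>s. Y / (Y - 1) * (ln (1 + s) - ln (Y + s))) has_real_derivative w s) (at s)" .
    have combine: "a - b \<le> 2 * (l + 1) / 2" if "a \<le> 0" "q \<le> l + 1" "b = - q" for a b q l :: real
      using that by simp
    have "ln (1 + s) \<le> ln (Y + s)" using s Y by simp
    then have "Y / (Y - 1) * (ln (1 + s) - ln (Y + s)) \<le> 0"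
      using Y by (intro mult_nonneg_nonpos) auto
    \<comment> \<open>The left side is the whole mass on the half-line. It exceeds
      \<open>ln Y\<close> by \<open>ln Y / (Y - 1)\<close>, which is at most 1 because
      \<open>ln Y \<le> Y - 1\<close>.\<close>
    moreover have "Y / (Y - 1) * ln Y \<le> ln Y + 1"
      using Y ln_le_minus_one[of Y] by (simp add: field_simps)
    moreover have "Y / (Y - 1) * (ln (1 + 0) - ln (Y + 0)) = - (Y / (Y - 1) * ln Y)" by simp
    ultimately show "Y / (Y - 1) * (ln (1 + s) - ln (Y + s)) - Y / (Y - 1) * (ln (1 + 0) - ln (Y + 0))
        \<le> 2 * (ln Y + 1) / 2" by (rule combine)
  qed
  \<comment> \<open>The error is a constant weight, covered by the bound with \<open>2 * T\<close>;
    \<open>c * T \<le> Y\<close> reduces its cost to 2. The form \<open>1 / Y * 1\<close> exhibits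
    it as a multiple of the weight 1 for \<open>weighted_null_energy_cmult\<close>.\<close>
  have X_1: "ennreal c * ?X (\<lambda>s. 1 / Y * 1) \<le> ennreal 2 * ?D"
  proof -
    have "ennreal c * ?X (\<lambda>s. 1 / Y * 1) = ennreal (c / Y) * ?X (\<lambda>_. 1)"
      using c Y by (subst weighted_null_energy_cmult[OF C2 c])
        (auto simp: ennreal_mult'[symmetric] mult.assoc[symmetric])
    also have "\<dots> \<le> ennreal (c / Y) * (ennreal (2 * T) * ?D)"
      by (intro mult_left_mono null_energy_total_bound[OF C2 wave c T]) auto
    also have "\<dots> = ennreal (2 * (c * T / Y)) * ?D"
      using c Y T by (simp add: ennreal_mult'[symmetric] mult.assoc[symmetric] mult.commute[of c 2])
    also have "\<dots> \<le> ennreal 2 * ?D"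
    proof (intro mult_right_mono ennreal_leI)
      have "c * T / Y \<le> 1" using Y by (subst divide_le_eq_1_pos) (auto simp: Y_def)
      then show "2 * (c * T / Y) \<le> 2" by simp
    qed simp
    finally show ?thesis .
  qed
  \<comment> \<open>The difference has denominator
    \<open>(1 + \<bar>s\<bar>) * (Y + \<bar>s\<bar>)\<close>, whose expansion contains
    \<open>Y * \<bar>s\<bar>\<close>; hence the bound \<open>1 / Y\<close>.\<close>
  have le: "1 / (1 + \<bar>s\<bar>) \<le> w s + 1 / Y * 1" for s
  proof -
    have "1 / (1 + \<bar>s\<bar>) - w s = \<bar>s\<bar> / ((1 + \<bar>s\<bar>) * (Y + \<bar>s\<bar>))"
      using Y by (simp add: w_def divide_simps add_nonneg_eq_0_iff)
    also have "\<dots> \<le> 1 / Y" using Y by (simp add: field_simps add_pos_nonneg)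
    finally show ?thesis by simp
  qed
  have "?X (\<lambda>s. 1 / (1 + \<bar>s\<bar>)) \<le> ?X (\<lambda>s. w s + 1 / Y * 1)"
    by (rule weighted_null_energy_mono[OF c le])
  also have "\<dots> = ?X w + ?X (\<lambda>s. 1 / Y * 1)"
    using Y by (intro weighted_null_energy_add[OF C2 c] cw w0) auto
  finally have "ennreal c * ?X (\<lambda>s. 1 / (1 + \<bar>s\<bar>)) \<le> ennreal c * (?X w + ?X (\<lambda>s. 1 / Y * 1))"
    by (rule mult_left_mono) simp
  also have "\<dots> \<le> ennreal (2 * (ln Y + 1)) * ?D + ennreal 2 * ?D"
    unfolding distrib_left[of "ennreal c"] by (rule add_mono[OF X_w X_1])
  also have "\<dots> = ennreal (2 * ln Y + 4) * ?D"
    using Y by (subst distrib_right[symmetric], subst ennreal_plus[symmetric]) (auto simp: add.commute)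
  finally show "ennreal c * ?X (\<lambda>s. 1 / (1 + \<bar>s\<bar>)) \<le> ennreal (2 * ln Y + 4) * ?D" .
  \<comment> \<open>\<open>ln (exp 1 + c * T)\<close> is at least \<open>ln Y\<close> and at least
    1, so six times it dominates \<open>2 * ln Y + 4\<close>.\<close>
  have "1 + c * T \<le> exp 1 + c * T" using exp_ge_add_one_self[of "1::real"] by simp
  then have "ln Y \<le> ln (exp 1 + c * T)" using Y by (intro ln_mono) (simp_all add: Y_def)
  moreover have "ln (exp 1) \<le> ln (exp 1 + c * T)" using c T by (intro ln_mono) auto
  ultimately show "1 / (6 * ln (exp 1 + c * T)) * (2 * ln Y + 4) \<le> 1"
    "0 \<le> 1 / (6 * ln (exp 1 + c * T))" by (auto simp: field_simps)
qed (use c in simp)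

theorem lemma1:
  fixes c T :: real
    and f g :: "real ^ 'n \<Rightarrow> real"
    and F u :: "real \<Rightarrow> real ^ 'n \<Rightarrow> real"
  assumes "c > 0" and "T > 0"
    and "wave_solution T c f g F u"
  shows
    "max (SUP t\<in>{0..T}. \<integral>\<^sup>+ x. ennreal ((dt T u t x)\<^sup>2 + c\<^sup>2 * (norm (grad (u t) x))\<^sup>2) \<partial>lborel)
      (max
        (SUP \<kappa>\<in>{0<..}. ennreal (c * \<kappa> / 4) *
          (\<integral>\<^sup>+ t\<in>{0..T}. (\<integral>\<^sup>+ x.
             ennreal (1 / (1 + \<bar>c * t - norm x\<bar>) powr (1 + \<kappa>) * tang_energy T c u t x)
           \<partial>lborel) \<partial>lborel))
        (ennreal (c / (6 * ln (exp 1 + c * T))) *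
          (\<integral>\<^sup>+ t\<in>{0..T}. (\<integral>\<^sup>+ x.
             ennreal (1 / (1 + \<bar>c * t - norm x\<bar>) * tang_energy T c u t x)
           \<partial>lborel) \<partial>lborel)))
     \<le> (\<integral>\<^sup>+ x. ennreal ((g x)\<^sup>2 + c\<^sup>2 * (norm (grad f x))\<^sup>2) \<partial>lborel)
       + 2 * (\<integral>\<^sup>+ t\<in>{0..T}. (\<integral>\<^sup>+ x. ennreal \<bar>dt T u t x * F t x\<bar> \<partial>lborel) \<partial>lborel)"
proof -
  have C2: "C_slab T 2 u"
    and wave: "\<And>t x. t \<in> {0..T} \<Longrightarrow> dt T (dt T u) t x - c\<^sup>2 * laplacian (u t) x = F t x"
    and init: "u 0 = f" "dt T u 0 = g"
    using assms(3) by (auto simp: wave_solution_def)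
  note hyps = C2 wave assms(1,2)
  have rhs: "(\<integral>\<^sup>+ x. ennreal ((g x)\<^sup>2 + c\<^sup>2 * (norm (grad f x))\<^sup>2) \<partial>lborel)
       + 2 * (\<integral>\<^sup>+ t\<in>{0..T}. (\<integral>\<^sup>+ x. ennreal \<bar>dt T u t x * F t x\<bar> \<partial>lborel) \<partial>lborel)
    = data_bound T c u F"
    unfolding data_bound_def energy_density_def init ..
  show ?thesis
    unfolding rhs weighted_tang_energy_eq[where w = "\<lambda>s. 1 / (1 + \<bar>s\<bar>) powr (1 + _)"]
      weighted_tang_energy_eq[where w = "\<lambda>s. 1 / (1 + \<bar>s\<bar>)"]
    using energy_bound[OF C2 wave assms(1)] power_weight_bound[OF hyps] log_weight_bound[OF hyps]
    by (intro max.boundedI SUP_least) (auto simp: energy_density_def)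
qed

end
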